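(* Let $(M,G,\psi)$ be a 4-form geometry, with flux operator $\mathbf H_\psi=\mathbf H^3_\psi:\Omega^3(M)\to\Omega^3(M)$ and flux 3-form $H_\psi$. Consider the decomposition $$\Omega^3(M)=\ker\mathbf H_\psi\oplus\bigoplus_d V_d,$$ where $V_d$ is the sum of all irreducible $G$-subbundles of rank $d$ contained in $(\ker \mathbf H_\psi)^\perp$. Each $V_d$ is $\mathbf H_\psi$-invariant and $\mathbf h_d:=\mathbf H_\psi|_{V_d}:V_d\to V_d$ is an isomorphism. Let $\operatorname{proj}_d:\Omega^3(M)\to V_d$ be the orthogonal projection and $\tau^d:=\operatorname{proj}_d(d^*\psi)$. Then $$H_\psi=\sum_d \mathbf h_d^{-1}(\tau^d).$$ In particular, suppose that $(\ker\mathbf H_\psi)^\perp=\Omega^3_1\oplus\cdots\oplus\Omega^3_m$ with the $\Omega^3_j$ pairwise non-isomorphic irreducible $G$-modules. Then $\mathbf H_\psi|_{\Omega^3_j}=a_j\cdot\mathrm{Id}_{\Omega^3_j}$ for non-zero constants $a_j\in\mathbb R$, and $$H_\psi=\sum_{j=1}^m\frac1{a_j}\tau^j,\qquad \tau^j:=\operatorname{proj}_{\Omega^3_j}(d^*\psi).$$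
   Context: A 4-form geometry $(M,G,\psi)$ consists of a connected oriented Riemannian manifold $(M^n,g)$, a closed Lie subgroup $G\subset\mathrm{SO}(n)$, a $G$-structure on $M$ (a reduction of the oriented orthonormal frame bundle to $G$), and a non-zero 4-form $\psi\in\Omega^4(M)$ which is pointwise modelled (in frames of the $G$-structure) on a fixed $\psi_0\in\Lambda^4(\mathbb R^n)^*$ with $G\subset\mathrm{Stab}_{\mathrm{SO}(n)}(\psi_0)$. Here $\Omega^q(M)$ also denotes the bundle $\Lambda^qT^*M$; "(irreducible) $G$-subbundle/$G$-module" means a subbundle associated with an (irreducible) real $G$-subrepresentation of $\Lambda^q(\mathbb R^n)^*$. With a local orthonormal frame $\{e_i\}$ put $\xi_{ij}=e_j\lrcorner(e_i\lrcorner\xi)$, i.e. $\xi_{ij}=\xi(e_i,e_j,\cdot,\ldots)$. The operators $\mathbf H^q_\psi:\Omega^q(M)\to\Omega^q(M)$ are $$\mathbf H^q_\psi(\xi)=\xi\lrcorner^2\psi:=\tfrac12\sum_{i,j}\xi_{ij}\wedge\psi_{ij};$$ they are $G$-equivariant and pointwise self-adjoint. The flux operator is $\mathbf H_\psi:=\mathbf H^3_\psi$. The flux 3-form $H_\psi$ is the unique 3-form in $(\ker\mathbf H_\psi)^\perp$ such that $\operatorname{proj}^\perp(d^*\psi)=\mathbf H_\psi(H_\psi)$, where $\operatorname{proj}^\perp$ is the orthogonal projection onto $(\ker\mathbf H_\psi)^\perp$ and $d^*$ is the Riemannian codifferential. *)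

theory Defs
  imports "HOL-Analysis.Analysis" "HOL-Library.Function_Algebras"
begin

subsection \<open>Functions into a real vector space\<close>

instantiation "fun" :: (type, real_vector) real_vector
begin

definition scaleR_fun :: "real \<Rightarrow> ('a \<Rightarrow> 'b) \<Rightarrow> 'a \<Rightarrow> 'b" where
  "scaleR_fun r f = (\<lambda>x. r *\<^sub>R f x)"

instance
  by standard (simp_all add: scaleR_fun_def plus_fun_def scaleR_add_right scaleR_add_left)

end

text \<open>The internal direct sum of the subspaces \<open>U i\<close>, \<open>i \<in> I\<close>, is all of \<open>V\<close>.\<close>

definition is_direct_sum :: "'i set \<Rightarrow> ('i \<Rightarrow> 'v::real_vector set) \<Rightarrow> 'v set \<Rightarrow> bool" where
  "is_direct_sum I U V \<longleftrightarrow>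
     finite I \<and> (\<forall>i\<in>I. subspace (U i)) \<and>
     V = {\<Sum>i\<in>I. x i | x. \<forall>i\<in>I. x i \<in> U i} \<and>
     (\<forall>x. (\<forall>i\<in>I. x i \<in> U i) \<and> (\<Sum>i\<in>I. x i) = 0 \<longrightarrow> (\<forall>i\<in>I. x i = 0))"

subsection \<open>Alternating forms\<close>

text \<open>
  A \<open>q\<close>-form on a linear subspace \<open>T\<close> is a function of the list of its \<open>q\<close> arguments,
  extended by zero to all other lists, so that equality of forms is equality of functions.
\<close>

type_synonym 'v form = "'v list \<Rightarrow> real"

definition alt_forms :: "'v::real_vector set \<Rightarrow> nat \<Rightarrow> 'v form set" where
  "alt_forms T q = {\<omega>.
     (\<forall>vs. \<not> (length vs = q \<and> set vs \<subseteq> T) \<longrightarrow> \<omega> vs = 0) \<and>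
     (\<forall>vs i x y a b. length vs = q \<and> set vs \<subseteq> T \<and> i < q \<and> x \<in> T \<and> y \<in> T \<longrightarrow>
        \<omega> (vs[i := a *\<^sub>R x + b *\<^sub>R y]) = a * \<omega> (vs[i := x]) + b * \<omega> (vs[i := y])) \<and>
     (\<forall>vs i j. length vs = q \<and> set vs \<subseteq> T \<and> i < q \<and> j < q \<and> i \<noteq> j \<and> vs ! i = vs ! j \<longrightarrow>
        \<omega> vs = 0)}"

definition contract :: "'v \<Rightarrow> 'v form \<Rightarrow> 'v form" where
  "contract v \<omega> = (\<lambda>vs. \<omega> (v # vs))"

text \<open>
  The wedge product of a \<open>p\<close>-form and a \<open>q\<close>-form, normalised so that
  \<open>(\<alpha> \<and> \<beta>)(v, w) = \<alpha>(v) \<beta>(w) - \<alpha>(w) \<beta>(v)\<close> for 1-forms.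
\<close>

definition wedge :: "nat \<Rightarrow> nat \<Rightarrow> 'v form \<Rightarrow> 'v form \<Rightarrow> 'v form" where
  "wedge p q \<alpha> \<beta> = (\<lambda>vs. if length vs = p + q
     then (\<Sum>\<sigma> | \<sigma> permutes {..<p + q}.
             of_int (sign \<sigma>) * \<alpha> (map (\<lambda>i. vs ! \<sigma> i) [0..<p])
                             * \<beta> (map (\<lambda>i. vs ! \<sigma> i) [p..<p + q])) / (fact p * fact q)
     else 0)"

subsection \<open>Representations on alternating forms\<close>

definition SO :: "(real^'n^'n) set" where
  "SO = {A. orthogonal_matrix A \<and> det A = 1}"

definition closed_subgroup_SO :: "(real^'n^'n) set \<Rightarrow> bool" where
  "closed_subgroup_SO G \<longleftrightarrow> G \<subseteq> SO \<and> closed G \<and> mat 1 \<in> G \<and>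
     (\<forall>A\<in>G. \<forall>B\<in>G. A ** B \<in> G) \<and> (\<forall>A\<in>G. matrix_inv A \<in> G)"

definition act :: "real^'n^'n \<Rightarrow> (real^'n) form \<Rightarrow> (real^'n) form" where
  "act A \<alpha> = (\<lambda>vs. \<alpha> (map ((*v) (matrix_inv A)) vs))"

definition subrep :: "(real^'n^'n) set \<Rightarrow> nat \<Rightarrow> (real^'n) form set \<Rightarrow> bool" where
  "subrep G q W \<longleftrightarrow> subspace W \<and> W \<subseteq> alt_forms UNIV q \<and> (\<forall>A\<in>G. act A ` W \<subseteq> W)"

definition irreducible_subrep :: "(real^'n^'n) set \<Rightarrow> nat \<Rightarrow> (real^'n) form set \<Rightarrow> bool" where
  "irreducible_subrep G q W \<longleftrightarrow> subrep G q W \<and> W \<noteq> {0} \<and>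
     (\<forall>U. subrep G q U \<and> U \<subseteq> W \<longrightarrow> U = {0} \<or> U = W)"

text \<open>
  The linear map \<open>f\<close> is defined on the ambient space of functions, but only its restriction
  to \<open>W\<close> matters: every linear map on a subspace extends.
\<close>

definition isomorphic_reps ::
    "(real^'n^'n) set \<Rightarrow> (real^'n) form set \<Rightarrow> (real^'n) form set \<Rightarrow> bool" where
  "isomorphic_reps G W W' \<longleftrightarrow>
     (\<exists>f. linear f \<and> bij_betw f W W' \<and> (\<forall>A\<in>G. \<forall>\<alpha>\<in>W. f (act A \<alpha>) = act A (f \<alpha>)))"

subsection \<open>Smooth maps and manifolds\<close>

primrec Ck_on ::
    "nat \<Rightarrow> 'a::real_normed_vector set \<Rightarrow> ('a \<Rightarrow> 'b::real_normed_vector) \<Rightarrow> bool" where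
  "Ck_on 0 S f \<longleftrightarrow> continuous_on S f"
| "Ck_on (Suc k) S f \<longleftrightarrow> (\<forall>x\<in>S. f differentiable (at x)) \<and>
     (\<forall>v. Ck_on k S (\<lambda>x. frechet_derivative f (at x) v))"

text \<open>Only used for open \<open>S\<close>.\<close>

definition smooth_on ::
    "'a::real_normed_vector set \<Rightarrow> ('a \<Rightarrow> 'b::real_normed_vector) \<Rightarrow> bool" where
  "smooth_on S f \<longleftrightarrow> (\<forall>k. Ck_on k S f)"

text \<open>A chart is a pair of a coordinate domain and a coordinate map.\<close>

type_synonym ('m, 'n) chart = "'m set \<times> ('m \<Rightarrow> real^'n)"

abbreviation cdom :: "('m, 'n) chart \<Rightarrow> 'm set" where
  "cdom c \<equiv> fst c"

abbreviation cmap :: "('m, 'n) chart \<Rightarrow> 'm \<Rightarrow> real^'n" where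
  "cmap c \<equiv> snd c"

abbreviation cinv :: "('m, 'n) chart \<Rightarrow> real^'n \<Rightarrow> 'm" where
  "cinv c \<equiv> inv_into (cdom c) (cmap c)"

text \<open>The derivative at \<open>p\<close> of the change of coordinates from \<open>c\<close> to \<open>c'\<close>.\<close>

definition jac :: "('m, 'n) chart \<Rightarrow> ('m, 'n) chart \<Rightarrow> 'm \<Rightarrow> real^'n \<Rightarrow> real^('n::finite)" where
  "jac c c' p = frechet_derivative (cmap c' \<circ> cinv c) (at (cmap c p))"

definition oriented_smooth_atlas ::
    "('m::topological_space, 'n::finite) chart set \<Rightarrow> bool" where
  "oriented_smooth_atlas \<A> \<longleftrightarrow>
     (\<Union>c\<in>\<A>. cdom c) = UNIV \<and>
     (\<forall>c\<in>\<A>. open (cdom c) \<and> open (cmap c ` cdom c) \<and>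
        homeomorphism (cdom c) (cmap c ` cdom c) (cmap c) (cinv c)) \<and>
     (\<forall>c\<in>\<A>. \<forall>c'\<in>\<A>. smooth_on (cmap c ` (cdom c \<inter> cdom c')) (cmap c' \<circ> cinv c)) \<and>
     (\<forall>c\<in>\<A>. \<forall>c'\<in>\<A>. \<forall>p\<in>cdom c \<inter> cdom c'. det (matrix (jac c c' p)) > 0)"

text \<open>
  A tangent vector at \<open>p\<close> is the family of its coordinate vectors in the charts around \<open>p\<close>
  (zero for all other charts), related by the derivatives of the coordinate changes.
\<close>

type_synonym ('m, 'n) tvec = "('m, 'n) chart \<Rightarrow> real^'n"

text \<open>
  Frames at \<open>p\<close> are indexed by \<open>'n\<close>; \<open>frames M p\<close> is the fibre over \<open>p\<close> of the
  \<open>grp M\<close>-structure.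
\<close>

record ('m, 'n) geometry =
  atlas :: "('m, 'n) chart set"
  metric :: "'m \<Rightarrow> ('m, 'n) tvec \<Rightarrow> ('m, 'n) tvec \<Rightarrow> real"
  grp :: "(real^'n^'n) set"
  frames :: "'m \<Rightarrow> ('n \<Rightarrow> ('m, 'n) tvec) set"
  psi :: "'m \<Rightarrow> ('m, 'n) tvec form"

definition tangent :: "('m, 'n::finite) geometry \<Rightarrow> 'm \<Rightarrow> ('m, 'n) tvec set" where
  "tangent M p = {v.
     (\<forall>c. \<not> (c \<in> atlas M \<and> p \<in> cdom c) \<longrightarrow> v c = 0) \<and>
     (\<forall>c\<in>atlas M. \<forall>c'\<in>atlas M. p \<in> cdom c \<inter> cdom c' \<longrightarrow> v c' = jac c c' p (v c))}"

text \<open>The tangent vector at \<open>p\<close> with coordinate vector \<open>x\<close> in the chart \<open>c\<close>.\<close>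

definition coord_vec ::
    "('m, 'n::finite) geometry \<Rightarrow> ('m, 'n) chart \<Rightarrow> 'm \<Rightarrow> real^'n \<Rightarrow> ('m, 'n) tvec" where
  "coord_vec M c p x = (\<lambda>c'. if c' \<in> atlas M \<and> p \<in> cdom c' then jac c c' p x else 0)"

definition riemannian_metric :: "('m, 'n::finite) geometry \<Rightarrow> bool" where
  "riemannian_metric M \<longleftrightarrow>
     (\<forall>p. \<forall>u\<in>tangent M p. \<forall>v\<in>tangent M p. \<forall>w\<in>tangent M p. \<forall>a b.
        metric M p (a *\<^sub>R u + b *\<^sub>R v) w = a * metric M p u w + b * metric M p v w) \<and>
     (\<forall>p. \<forall>v\<in>tangent M p. \<forall>w\<in>tangent M p. metric M p v w = metric M p w v) \<and>
     (\<forall>p. \<forall>v\<in>tangent M p. v \<noteq> 0 \<longrightarrow> metric M p v v > 0) \<and>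
     (\<forall>c\<in>atlas M. \<forall>x y. smooth_on (cmap c ` cdom c)
        (\<lambda>z. metric M (cinv c z) (coord_vec M c (cinv c z) x) (coord_vec M c (cinv c z) y)))"

abbreviation forms_at :: "('m, 'n::finite) geometry \<Rightarrow> nat \<Rightarrow> 'm \<Rightarrow> ('m, 'n) tvec form set" where
  "forms_at M q p \<equiv> alt_forms (tangent M p) q"

definition smooth_form ::
    "('m, 'n::finite) geometry \<Rightarrow> nat \<Rightarrow> ('m \<Rightarrow> ('m, 'n) tvec form) \<Rightarrow> bool" where
  "smooth_form M q \<omega> \<longleftrightarrow> (\<forall>p. \<omega> p \<in> forms_at M q p) \<and>
     (\<forall>c\<in>atlas M. \<forall>xs. smooth_on (cmap c ` cdom c)
        (\<lambda>z. \<omega> (cinv c z) (map (coord_vec M c (cinv c z)) xs)))"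

subsection \<open>G-structures\<close>

definition oriented_orthonormal_frames ::
    "('m, 'n::finite) geometry \<Rightarrow> 'm \<Rightarrow> ('n \<Rightarrow> ('m, 'n) tvec) set" where
  "oriented_orthonormal_frames M p = {e.
     (\<forall>i. e i \<in> tangent M p) \<and>
     (\<forall>i j. metric M p (e i) (e j) = (if i = j then 1 else 0)) \<and>
     (\<forall>c\<in>atlas M. p \<in> cdom c \<longrightarrow> det (\<chi> i j. e j c $ i) > 0)}"

definition frame_act ::
    "('n \<Rightarrow> 'v::real_vector) \<Rightarrow> real^'n^'n \<Rightarrow> ('n::finite \<Rightarrow> 'v)" where
  "frame_act e A = (\<lambda>j. \<Sum>i\<in>UNIV. (A $ i $ j) *\<^sub>R e i)"

text \<open>
  A reduction of the oriented orthonormal frame bundle: the fibres are single \<open>G\<close>-orbits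
  of frames, and there are smooth local sections.
\<close>

definition G_structure :: "('m::topological_space, 'n::finite) geometry \<Rightarrow> bool" where
  "G_structure M \<longleftrightarrow>
     (\<forall>p. frames M p \<subseteq> oriented_orthonormal_frames M p) \<and>
     (\<forall>p. \<forall>e\<in>frames M p. frames M p = frame_act e ` grp M) \<and>
     (\<forall>p. \<exists>U s. open U \<and> p \<in> U \<and> (\<forall>q\<in>U. s q \<in> frames M q) \<and>
        (\<forall>c\<in>atlas M. \<forall>i. smooth_on (cmap c ` (U \<inter> cdom c)) (\<lambda>z. s (cinv c z) i c)))"

text \<open>The pullback of a form at \<open>p\<close> along the map from \<open>\<real>\<^sup>n\<close> defined by a frame.\<close>

definition frame_pullback ::
    "('n::finite \<Rightarrow> 'v::real_vector) \<Rightarrow> 'v form \<Rightarrow> (real^'n) form" where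
  "frame_pullback e \<omega> = (\<lambda>xs. \<omega> (map (\<lambda>x. \<Sum>i\<in>UNIV. (x $ i) *\<^sub>R e i) xs))"

definition four_form_geometry ::
    "('m::{t2_space,second_countable_topology}, 'n::finite) geometry \<Rightarrow> bool" where
  "four_form_geometry M \<longleftrightarrow>
     connected (UNIV :: 'm set) \<and>
     oriented_smooth_atlas (atlas M) \<and>
     riemannian_metric M \<and>
     closed_subgroup_SO (grp M) \<and>
     G_structure M \<and>
     smooth_form M 4 (psi M) \<and> (\<exists>p. psi M p \<noteq> 0) \<and>
     (\<exists>\<psi>\<^sub>0\<in>alt_forms UNIV 4. (\<forall>A\<in>grp M. act A \<psi>\<^sub>0 = \<psi>\<^sub>0) \<and>
        (\<forall>p. \<forall>e\<in>frames M p. frame_pullback e (psi M p) = \<psi>\<^sub>0))"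

text \<open>The fibre over \<open>p\<close> of the subbundle associated with \<open>W\<close>.\<close>

definition assoc_bundle ::
    "('m, 'n::finite) geometry \<Rightarrow> nat \<Rightarrow> (real^'n) form set \<Rightarrow> 'm \<Rightarrow> ('m, 'n) tvec form set" where
  "assoc_bundle M q W p = {\<xi> \<in> forms_at M q p. \<exists>e\<in>frames M p. frame_pullback e \<xi> \<in> W}"

definition irreducible_subbundle ::
    "('m, 'n::finite) geometry \<Rightarrow> nat \<Rightarrow> nat \<Rightarrow> ('m \<Rightarrow> ('m, 'n) tvec form set) \<Rightarrow> bool" where
  "irreducible_subbundle M q d E \<longleftrightarrow>
     (\<exists>W. irreducible_subrep (grp M) q W \<and> dim W = d \<and> E = assoc_bundle M q W)"

subsection \<open>Inner product, Hodge star and codifferential\<close>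

text \<open>The constructions below do not depend on the choice of the frame.\<close>

definition onb :: "('m, 'n::finite) geometry \<Rightarrow> 'm \<Rightarrow> 'n \<Rightarrow> ('m, 'n) tvec" where
  "onb M p = (SOME e. e \<in> oriented_orthonormal_frames M p)"

definition form_inner ::
    "('m, 'n::finite) geometry \<Rightarrow> nat \<Rightarrow> 'm \<Rightarrow> ('m, 'n) tvec form \<Rightarrow> ('m, 'n) tvec form \<Rightarrow> real" where
  "form_inner M q p \<alpha> \<beta> =
     (\<Sum>is | length is = q. \<alpha> (map (onb M p) is) * \<beta> (map (onb M p) is)) / fact q"

definition orth_proj ::
    "('m, 'n::finite) geometry \<Rightarrow> nat \<Rightarrow> 'm \<Rightarrow> ('m, 'n) tvec form set \<Rightarrow>
       ('m, 'n) tvec form \<Rightarrow> ('m, 'n) tvec form" where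
  "orth_proj M q p W \<xi> = (THE \<eta>. \<eta> \<in> W \<and> (\<forall>\<omega>\<in>W. form_inner M q p (\<xi> - \<eta>) \<omega> = 0))"

text \<open>
  The Riemannian volume form, equal to 1 on an oriented orthonormal frame listed in
  increasing order of its index.
\<close>

definition vol :: "('m, 'n::{finite,linorder}) geometry \<Rightarrow> 'm \<Rightarrow> ('m, 'n) tvec form" where
  "vol M p = (\<lambda>vs. if length vs = CARD('n) \<and> set vs \<subseteq> tangent M p
     then det (\<chi> i (j::'n). metric M p (onb M p i) (vs ! card {k. k < j})) else 0)"

text \<open>The Hodge star of a \<open>q\<close>-form: \<open>\<alpha> \<and> \<star>\<omega> = \<langle>\<alpha>, \<omega>\<rangle> vol\<close>.\<close>

definition hodge ::
    "('m, 'n::{finite,linorder}) geometry \<Rightarrow> nat \<Rightarrow> 'm \<Rightarrow> ('m, 'n) tvec form \<Rightarrow> ('m, 'n) tvec form" where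
  "hodge M q p \<omega> = (\<lambda>ws. if length ws + q = CARD('n) \<and> set ws \<subseteq> tangent M p
     then (\<Sum>is | length is = q. \<omega> (map (onb M p) is) * vol M p (map (onb M p) is @ ws)) / fact q
     else 0)"

text \<open>
  The exterior derivative of a \<open>q\<close>-form, in a chart \<open>c\<close> around \<open>p\<close>:
  \<open>d\<omega>(x\<^sub>0, \<dots>, x\<^sub>q) = \<Sum>\<^sub>i (-1)\<^sup>i \<partial>\<^bsub>x\<^sub>i\<^esub> \<omega>(x\<^sub>0, \<dots>, x\<^bsub>i-1\<^esub>, x\<^bsub>i+1\<^esub>, \<dots>, x\<^sub>q)\<close> for constant
  coordinate vector fields \<open>x\<^sub>i\<close>.
\<close>

definition ext_deriv ::
    "('m, 'n::finite) geometry \<Rightarrow> nat \<Rightarrow> ('m \<Rightarrow> ('m, 'n) tvec form) \<Rightarrow> 'm \<Rightarrow> ('m, 'n) tvec form" where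
  "ext_deriv M q \<omega> p = (\<lambda>vs. if length vs = Suc q \<and> set vs \<subseteq> tangent M p
     then (let c = (SOME c. c \<in> atlas M \<and> p \<in> cdom c); xs = map (\<lambda>v. v c) vs in
       \<Sum>i\<le>q. (-1) ^ i *
         frechet_derivative
           (\<lambda>z. \<omega> (cinv c z) (map (coord_vec M c (cinv c z)) (take i xs @ drop (Suc i) xs)))
           (at (cmap c p)) (xs ! i))
     else 0)"

text \<open>The codifferential \<open>d\<^sup>* = (-1)\<^bsup>n(q+1)+1\<^esup> \<star>d\<star>\<close> on \<open>q\<close>-forms, \<open>1 \<le> q \<le> n\<close>.\<close>

definition codiff ::
    "('m, 'n::{finite,linorder}) geometry \<Rightarrow> nat \<Rightarrow> ('m \<Rightarrow> ('m, 'n) tvec form) \<Rightarrow>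
       'm \<Rightarrow> ('m, 'n) tvec form" where
  "codiff M q \<omega> p = (-1) ^ (CARD('n) * (q + 1) + 1) *\<^sub>R
     hodge M (CARD('n) - q + 1) p
       (ext_deriv M (CARD('n) - q) (\<lambda>p'. hodge M q p' (\<omega> p')) p)"

subsection \<open>The flux operator and the flux form\<close>

definition H_op ::
    "('m, 'n::finite) geometry \<Rightarrow> nat \<Rightarrow> 'm \<Rightarrow> ('m, 'n) tvec form \<Rightarrow> ('m, 'n) tvec form" where
  "H_op M q p \<xi> = (1/2) *\<^sub>R (\<Sum>i\<in>UNIV. \<Sum>j\<in>UNIV.
     wedge (q - 2) 2 (contract (onb M p j) (contract (onb M p i) \<xi>))
                     (contract (onb M p j) (contract (onb M p i) (psi M p))))"

abbreviation flux_op ::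
    "('m, 'n::finite) geometry \<Rightarrow> 'm \<Rightarrow> ('m, 'n) tvec form \<Rightarrow> ('m, 'n) tvec form" where
  "flux_op M \<equiv> H_op M 3"

definition flux_ker :: "('m, 'n::finite) geometry \<Rightarrow> 'm \<Rightarrow> ('m, 'n) tvec form set" where
  "flux_ker M p = {\<xi> \<in> forms_at M 3 p. flux_op M p \<xi> = 0}"

definition flux_ker_perp :: "('m, 'n::finite) geometry \<Rightarrow> 'm \<Rightarrow> ('m, 'n) tvec form set" where
  "flux_ker_perp M p = {\<xi> \<in> forms_at M 3 p. \<forall>\<eta>\<in>flux_ker M p. form_inner M 3 p \<xi> \<eta> = 0}"

text \<open>
  The defining condition of the flux 3-form is algebraic at each point and determines a section
  of the bundle of 3-forms uniquely among all sections, smooth or not.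
\<close>

definition flux_form :: "('m, 'n::{finite,linorder}) geometry \<Rightarrow> 'm \<Rightarrow> ('m, 'n) tvec form" where
  "flux_form M = (THE H. \<forall>p. H p \<in> flux_ker_perp M p \<and>
     orth_proj M 3 p (flux_ker_perp M p) (codiff M 4 (psi M) p) = flux_op M p (H p))"

text \<open>
  The irreducible subbundles of rank \<open>d\<close> contained in the orthogonal complement of the kernel,
  the ranks that occur, and the sum \<open>V\<^sub>d\<close> of all those of rank \<open>d\<close>
  (the zero bundle if \<open>d\<close> does not occur).
\<close>

definition perp_subbundles ::
    "('m, 'n::finite) geometry \<Rightarrow> nat \<Rightarrow> ('m \<Rightarrow> ('m, 'n) tvec form set) set" where
  "perp_subbundles M d = {E. irreducible_subbundle M 3 d E \<and> (\<forall>p. E p \<subseteq> flux_ker_perp M p)}"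

definition perp_ranks :: "('m, 'n::finite) geometry \<Rightarrow> nat set" where
  "perp_ranks M = {d. perp_subbundles M d \<noteq> {}}"

definition V_bundle :: "('m, 'n::finite) geometry \<Rightarrow> nat \<Rightarrow> 'm \<Rightarrow> ('m, 'n) tvec form set" where
  "V_bundle M d p = span (\<Union>E\<in>perp_subbundles M d. E p)"

text \<open>The component of \<open>d\<^sup>*\<psi>\<close> in the subbundle \<open>E\<close>.\<close>

definition tau ::
    "('m, 'n::{finite,linorder}) geometry \<Rightarrow> ('m \<Rightarrow> ('m, 'n) tvec form set) \<Rightarrow>
       'm \<Rightarrow> ('m, 'n) tvec form" where
  "tau M E p = orth_proj M 3 p (E p) (codiff M 4 (psi M) p)"

end

theory Submission
  imports Defs
begin

text \<open>
  In a frame of the \<open>G\<close>-structure the flux operator becomes one fixed endomorphism \<open>H\<close> of the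
  alternating arrays, the same at all points; it is self-adjoint because the coefficients of
  \<open>\<psi>\<close> are symmetric under exchange of the first and the last two indices, and it commutes with
  \<open>G\<close> because \<open>\<psi>\<close> has the same coefficients in all frames of the \<open>G\<close>-structure. On the orthogonal
  complement of its kernel \<open>H\<close> is injective, so it maps an irreducible summand to an irreducible
  summand of the same dimension and preserves each \<open>V\<^sub>d\<close>. By Schur's lemma non-isomorphic
  irreducible summands are orthogonal, hence so are the \<open>V\<^sub>d\<close>, and the equation for the flux form
  splits into its components. In the multiplicity-free case \<open>H\<close> preserves each summand, and an
  eigenspace in it is invariant, hence everything.
\<close>

section \<open>Orthogonal representations and self-adjoint intertwiners\<close>

text \<open>Forms are functions on lists, a type that carries neither an inner product nor a finite
  dimension, and the fibres over different points are different subspaces of it. The linear algebra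
  is therefore done once, on a subspace of the Euclidean space \<open>real^'n^'n^'n\<close> of
  component arrays, and then moved into every fibre. Since a subbundle comes from one subspace of
  arrays for all points together, the ranks and the constants \<open>a j\<close> do not depend on
  the point. Two frames meet at each point: \<open>H_op\<close> and \<open>form_inner\<close> are
  tied to \<open>onb M p\<close>, an arbitrary oriented orthonormal frame, whereas \<psi> is known
  to have constant coefficients only in frames of the G-structure. The two frames differ by an
  orthogonal matrix, to which contractions over orthonormal frames are insensitive. The
  codifferential enters only as a vector to be projected, so every claim becomes algebra at a single
  point.\<close>

definition projection :: "'e::euclidean_space set \<Rightarrow> 'e \<Rightarrow> 'e" where
  "projection W = (SOME P. linear P \<and> (\<forall>x. P x \<in> W) \<and> (\<forall>x. \<forall>w\<in>W. (x - P x) \<bullet> w = 0))"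

lemma
  fixes W :: "'e::euclidean_space set"
  assumes "subspace W"
  shows linear_projection: "linear (projection W)"
    and projection_in: "projection W x \<in> W"
    and projection_orthogonal: "w \<in> W \<Longrightarrow> (x - projection W x) \<bullet> w = 0"
proof -
  obtain B where B: "B \<subseteq> W" "pairwise orthogonal B" "\<And>x. x \<in> B \<Longrightarrow> norm x = 1"
      "independent B" "span B = W"
    using orthonormal_basis_subspace[OF assms] by metis
  have fB: "finite B" using B(4) independent_imp_finite by blast
  define P where "P = (\<lambda>x. \<Sum>b\<in>B. (x \<bullet> b) *\<^sub>R b)"
  have "linear P"
    unfolding P_def
    by (rule linearI) (simp_all add: inner_add_left scaleR_add_left sum.distrib scaleR_sum_right)
  moreover have "P x \<in> W" for x
    unfolding P_def using B(1) assms by (intro subspace_sum subspace_scale) auto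
  moreover have "(x - P x) \<bullet> w = 0" if "w \<in> W" for x w
  proof -
    have *: "(x - P x) \<bullet> b = 0" if "b \<in> B" for b
    proof -
      have "P x \<bullet> b = (\<Sum>c\<in>B. if c = b then x \<bullet> b else 0)"
        unfolding P_def inner_sum_left
      proof (rule sum.cong[OF refl])
        fix c assume "c \<in> B"
        show "(x \<bullet> c) *\<^sub>R c \<bullet> b = (if c = b then x \<bullet> b else 0)"
          using B(3)[OF that] pairwiseD[OF B(2) \<open>c \<in> B\<close> that]
          by (auto simp: orthogonal_def norm_eq_1)
      qed
      then show ?thesis using that fB by (simp add: inner_diff_left)
    qed
    from that have "w \<in> span B" by (simp add: B(5))
    then show ?thesis
      by (induction rule: span_induct_alt) (auto simp: inner_add_right *)
  qed
  ultimately have "\<exists>P. linear P \<and> (\<forall>x. P x \<in> W) \<and> (\<forall>x. \<forall>w\<in>W. (x - P x) \<bullet> w = 0)" by blast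
  from someI_ex[OF this]
  show "linear (projection W)" "projection W x \<in> W" "w \<in> W \<Longrightarrow> (x - projection W x) \<bullet> w = 0"
    unfolding projection_def by blast+
qed

lemma orthogonal_to_spans:
  fixes S T :: "'e::real_inner set"
  assumes "\<And>x y. x \<in> S \<Longrightarrow> y \<in> T \<Longrightarrow> x \<bullet> y = 0" "x \<in> span S" "y \<in> span T"
  shows "x \<bullet> y = 0"
proof -
  have *: "x \<bullet> y = 0" if "x \<in> S" for x
    using assms(3) by (induction rule: span_induct_alt) (auto simp: inner_add_right assms(1) that)
  show ?thesis
    using assms(2) by (induction rule: span_induct_alt) (auto simp: inner_add_left *)
qed

text \<open>The Rayleigh quotient attains its maximum \<open>a\<close> on the compact unit sphere of
  \<open>W\<close>, and a maximiser is an eigenvector for \<open>a\<close>.\<close>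

lemma self_adjoint_eigenvector:
  fixes H :: "'e::euclidean_space \<Rightarrow> 'e"
  assumes "linear H" "subspace W" "W \<noteq> {0}" "H ` W \<subseteq> W"
    and sa: "\<And>x y. x \<in> W \<Longrightarrow> y \<in> W \<Longrightarrow> H x \<bullet> y = x \<bullet> H y"
  obtains a x where "x \<in> W" "x \<noteq> 0" "H x = a *\<^sub>R x"
proof -
  let ?S = "W \<inter> sphere 0 1"
  obtain w where w: "w \<in> W" "w \<noteq> 0"
    using assms(2,3) subspace_0 by blast
  have "(1 / norm w) *\<^sub>R w \<in> ?S"
    using w assms(2) by (simp add: subspace_scale)
  moreover have "compact ?S"
    using closed_subspace[OF assms(2)] by (metis compact_Int_closed compact_sphere inf_commute)
  moreover have "continuous_on ?S (\<lambda>x. H x \<bullet> x)"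
    by (intro continuous_intros linear_continuous_on linear_conv_bounded_linear[THEN iffD1] assms(1))
  ultimately obtain x where x: "x \<in> ?S" and max: "\<And>y. y \<in> ?S \<Longrightarrow> H y \<bullet> y \<le> H x \<bullet> x"
    using continuous_attains_sup[of ?S "\<lambda>x. H x \<bullet> x"] by blast
  define a where "a = H x \<bullet> x"
  have xx: "x \<bullet> x = 1" using x by (simp add: norm_eq_1)
  have pos: "H y \<bullet> y \<le> a * (y \<bullet> y)" if "y \<in> W" for y
  proof (cases "y = 0")
    case False
    have "(1 / norm y) *\<^sub>R y \<in> ?S"
      using False that assms(2) by (simp add: subspace_scale)
    from max[OF this] have "(H y \<bullet> y) / (norm y)\<^sup>2 \<le> a"
      by (simp add: a_def linear_scale[OF assms(1)] power2_eq_square)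
    then show ?thesis using False
      by (simp add: divide_le_eq power2_norm_eq_inner)
  qed (simp add: linear_0[OF assms(1)])
  define r where "r = a *\<^sub>R x - H x"
  have rW: "r \<in> W" unfolding r_def using x assms(2,4)
    by (auto intro!: subspace_diff subspace_scale)
  \<comment> \<open>The form \<open>a \<langle>y,y\<rangle> - \<langle>H y,y\<rangle>\<close> is nonnegative on \<open>W\<close> and vanishes at \<open>x\<close>,
    so its first variation at \<open>x\<close> in the direction \<open>r\<close>, which is \<open>2 \<langle>r,r\<rangle>\<close>, vanishes.\<close>
  have quad: "0 \<le> 2 * t * (r \<bullet> r) + t\<^sup>2 * (a * (r \<bullet> r) - H r \<bullet> r)" for t
  proof -
    have "x + t *\<^sub>R r \<in> W" using x rW assms(2) by (auto intro!: subspace_add subspace_scale)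
    from pos[OF this] have "0 \<le> a * ((x + t *\<^sub>R r) \<bullet> (x + t *\<^sub>R r)) - H (x + t *\<^sub>R r) \<bullet> (x + t *\<^sub>R r)"
      by simp
    also have "\<dots> = a * (x \<bullet> x) - H x \<bullet> x + 2 * t * (a * (x \<bullet> r) - H x \<bullet> r)
        + t\<^sup>2 * (a * (r \<bullet> r) - H r \<bullet> r)"
      using sa[of r x] rW x
      by (simp add: linear_add[OF assms(1)] linear_scale[OF assms(1)] inner_add_left inner_add_right
          algebra_simps power2_eq_square inner_commute)
    also have "a * (x \<bullet> r) - H x \<bullet> r = r \<bullet> r"
      by (simp add: r_def inner_diff_left inner_diff_right algebra_simps inner_commute)
    finally show ?thesis by (simp add: a_def xx)
  qed
  define s where "s = r \<bullet> r"
  define b where "b = a * (r \<bullet> r) - H r \<bullet> r"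
  have b0: "0 \<le> b" unfolding b_def using pos[OF rW] by simp
  have "s = 0"
  proof (rule ccontr)
    assume "s \<noteq> 0"
    \<comment> \<open>For small negative \<open>t\<close> the linear term of the quadratic
      inequality dominates; \<open>t = - s / (b + 1)\<close> makes this explicit, the 1 keeping the
      denominator positive when \<open>b = 0\<close>.\<close>
    define u where "u = s / (b + 1)"
    have su: "s = u * (b + 1)" "u \<noteq> 0"
      using b0 \<open>s \<noteq> 0\<close> by (simp_all add: u_def)
    have "0 \<le> 2 * (- u) * s + (- u)\<^sup>2 * b"
      using quad[of "- u"] by (simp add: s_def b_def)
    also have "\<dots> = - (u\<^sup>2 * (b + 2))"
      by (simp add: su(1) algebra_simps power2_eq_square)
    also have "\<dots> < 0"
      using su(2) b0 by simp
    finally show False by simp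
  qed
  then have "H x = a *\<^sub>R x" by (simp add: s_def r_def)
  moreover have "x \<noteq> 0" using xx by auto
  ultimately show ?thesis using that[of x a] x by auto
qed

section \<open>Invariant subspaces, complete reducibility and Schur's lemma\<close>

locale orthogonal_rep =
  fixes A :: "'e::euclidean_space set" and \<G> :: "('e \<Rightarrow> 'e) set"
  assumes subspace_A: "subspace A"
    and linear_G: "g \<in> \<G> \<Longrightarrow> linear g"
    and inner_G: "g \<in> \<G> \<Longrightarrow> g x \<bullet> g y = x \<bullet> y"
    and G_A: "g \<in> \<G> \<Longrightarrow> x \<in> A \<Longrightarrow> g x \<in> A"
begin

definition invariant :: "'e set \<Rightarrow> bool" where
  "invariant W \<longleftrightarrow> subspace W \<and> W \<subseteq> A \<and> (\<forall>g\<in>\<G>. \<forall>x\<in>W. g x \<in> W)"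

definition irreducible_rep :: "'e set \<Rightarrow> bool" where
  "irreducible_rep W \<longleftrightarrow> invariant W \<and> W \<noteq> {0} \<and>
     (\<forall>U. invariant U \<and> U \<subseteq> W \<longrightarrow> U = {0} \<or> U = W)"

lemma inj_G: "g \<in> \<G> \<Longrightarrow> inj g"
proof -
  assume g: "g \<in> \<G>"
  have "x = 0" if "g x = 0" for x
    using inner_G[OF g, of x x] that by simp
  then show ?thesis using linear_injective_0[OF linear_G[OF g]] by blast
qed

text \<open>Finite dimension stands in for inverses: an injective map of \<open>W\<close> into
  itself is onto. This lets any vector of \<open>W\<close> be written as \<open>g w'\<close>, which
  makes orthogonal complements invariant.\<close>

lemma image_G: "invariant W \<Longrightarrow> g \<in> \<G> \<Longrightarrow> g ` W = W"
proof -
  assume W: "invariant W" and g: "g \<in> \<G>"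
  have "dim (g ` W) = dim W"
    using dim_image_eq[OF linear_G[OF g]] inj_G[OF g] by (meson inj_on_subset subset_UNIV)
  then show ?thesis
    using W g linear_subspace_image[OF linear_G[OF g]]
    by (intro subspace_dim_equal) (auto simp: invariant_def)
qed

lemma invariant_A: "invariant A"
  using subspace_A G_A by (auto simp: invariant_def)

lemma invariant_complement:
  assumes "invariant X" "invariant W"
  shows "invariant {x \<in> X. \<forall>w\<in>W. x \<bullet> w = 0}"
proof -
  have "subspace {x \<in> X. \<forall>w\<in>W. x \<bullet> w = 0}"
    using assms by (auto simp: invariant_def subspace_def inner_add_left)
  moreover have "g x \<bullet> w = 0" if "g \<in> \<G>" "w \<in> W" and "\<forall>w\<in>W. x \<bullet> w = 0" for g x w
  proof -
    obtain w' where "w' \<in> W" "w = g w'" using image_G[OF assms(2) \<open>g \<in> \<G>\<close>] \<open>w \<in> W\<close> by blast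
    then show ?thesis using inner_G[OF \<open>g \<in> \<G>\<close>] that by simp
  qed
  ultimately show ?thesis using assms(1) by (auto simp: invariant_def)
qed

lemma invariant_span:
  assumes "\<And>W. W \<in> \<W> \<Longrightarrow> invariant W"
  shows "invariant (span (\<Union>\<W>))"
proof -
  have "g ` span (\<Union>\<W>) \<subseteq> span (\<Union>\<W>)" if "g \<in> \<G>" for g
  proof -
    have "g ` \<Union>\<W> \<subseteq> \<Union>\<W>" using assms that unfolding invariant_def by blast
    then show ?thesis
      using span_linear_image[OF linear_G[OF that]] span_mono by metis
  qed
  moreover have "span (\<Union>\<W>) \<subseteq> A"
    using assms by (intro span_minimal subspace_A) (auto simp: invariant_def)
  ultimately show ?thesis by (auto simp: invariant_def)
qed

lemma irreducible_rep_exists: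
  "invariant W \<Longrightarrow> W \<noteq> {0} \<Longrightarrow> \<exists>U. irreducible_rep U \<and> U \<subseteq> W"
proof (induction "dim W" arbitrary: W rule: less_induct)
  case less
  show ?case
  proof (cases "irreducible_rep W")
    case False
    then obtain U where U: "invariant U" "U \<subseteq> W" "U \<noteq> {0}" "U \<noteq> W"
      using less.prems by (auto simp: irreducible_rep_def)
    have "dim U < dim W"
      using U less.prems by (metis dim_psubset invariant_def psubsetI span_eq_iff)
    then show ?thesis using less.hyps U by (meson order.trans)
  qed blast
qed

text \<open>If the irreducible subspaces did not span \<open>W\<close>, the orthogonal complement of
  their span in \<open>W\<close> would contain a further one, which would then be orthogonal to
  itself.\<close>

lemma completely_reducible:
  assumes "invariant W"
  shows "span (\<Union>{U. irreducible_rep U \<and> U \<subseteq> W}) = W"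
proof -
  let ?S = "span (\<Union>{U. irreducible_rep U \<and> U \<subseteq> W})"
  have S: "invariant ?S" by (rule invariant_span) (auto simp: irreducible_rep_def)
  have SW: "?S \<subseteq> W" using assms by (intro span_minimal) (auto simp: invariant_def)
  let ?C = "{x \<in> W. \<forall>w\<in>?S. x \<bullet> w = 0}"
  have C: "invariant ?C" by (rule invariant_complement[OF assms S])
  have "?C = {0}"
  proof (rule ccontr)
    assume "?C \<noteq> {0}"
    then obtain U where U: "irreducible_rep U" "U \<subseteq> ?C" using irreducible_rep_exists[OF C] by blast
    then have "U \<subseteq> \<Union>{U. irreducible_rep U \<and> U \<subseteq> W}" by blast
    then have "U \<subseteq> ?S" using span_superset by (rule order.trans)
    then have "U \<subseteq> {0}" using U(2) by fastforce
    moreover have "0 \<in> U" using U by (simp add: irreducible_rep_def invariant_def subspace_0)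
    ultimately show False using U by (auto simp: irreducible_rep_def)
  qed
  moreover have "W \<subseteq> ?S"
  proof
    fix x assume x: "x \<in> W"
    let ?P = "projection ?S"
    note P = projection_in[OF subspace_span[of "\<Union>{U. irreducible_rep U \<and> U \<subseteq> W}"]]
      projection_orthogonal[OF subspace_span[of "\<Union>{U. irreducible_rep U \<and> U \<subseteq> W}"]]
    have "x - ?P x \<in> ?C"
      using x P SW assms by (auto simp: invariant_def intro!: subspace_diff)
    then have "x = ?P x" using \<open>?C = {0}\<close> by auto
    then show "x \<in> ?S" using P(1) by metis
  qed
  ultimately show ?thesis using SW by blast
qed

text \<open>The kernel in \<open>W\<close> and the image of \<open>W\<close> are invariant, so
  irreducibility leaves only the extreme cases. Equivariance is asked on \<open>W\<close> alone,
  since the flux operator on arrays commutes with the group only on the alternating ones.\<close>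

lemma schur:
  assumes "irreducible_rep W" "irreducible_rep W'" "linear f" "f ` W \<subseteq> W'"
    and eq: "\<And>g x. g \<in> \<G> \<Longrightarrow> x \<in> W \<Longrightarrow> f (g x) = g (f x)"
  shows "(\<forall>x\<in>W. f x = 0) \<or> bij_betw f W W'"
proof -
  have W: "invariant W" and W': "invariant W'" using assms by (auto simp: irreducible_rep_def)
  have "invariant {x \<in> W. f x = 0}"
    using W assms(3)
    by (auto simp: invariant_def subspace_def linear_0 linear_add linear_scale eq linear_G)
  then consider "{x \<in> W. f x = 0} = W" | "{x \<in> W. f x = 0} = {0}"
    using assms(1) by (auto simp: irreducible_rep_def)
  then show ?thesis
  proof cases
    case 2
    have "inj_on f W"
      using 2 W linear_injective_on_subspace_0[OF assms(3)] by (auto simp: invariant_def)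
    moreover have "g (f x) \<in> f ` W" if "g \<in> \<G>" "x \<in> W" for g x
      using eq[OF that] W that by (metis image_eqI invariant_def)
    then have "invariant (f ` W)"
      using W W' assms(4) linear_subspace_image[OF assms(3)] by (auto simp: invariant_def)
    then have "f ` W = {0} \<or> f ` W = W'" using assms(2,4) by (auto simp: irreducible_rep_def)
    ultimately show ?thesis by (auto simp: bij_betw_def)
  qed auto
qed

lemma orthogonal_or_isomorphic:
  assumes "irreducible_rep W" "irreducible_rep W'" "linear f"
    and eq: "\<And>g x. g \<in> \<G> \<Longrightarrow> x \<in> W \<Longrightarrow> f (g x) = g (f x)"
  shows "(\<forall>x\<in>W. \<forall>y\<in>W'. f x \<bullet> y = 0) \<or>
    (\<exists>h. linear h \<and> bij_betw h W W' \<and> (\<forall>g\<in>\<G>. \<forall>x\<in>W. h (g x) = g (h x)))"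
proof -
  have W': "invariant W'" using assms by (auto simp: irreducible_rep_def)
  define P where "P = projection W'"
  have P: "linear P" "\<And>x. P x \<in> W'" "\<And>x w. w \<in> W' \<Longrightarrow> (x - P x) \<bullet> w = 0"
    using linear_projection projection_in projection_orthogonal W' unfolding P_def invariant_def by blast+
  \<comment> \<open>The discrepancy \<open>?z\<close> lies in \<open>W'\<close> and is orthogonal to
    every \<open>g w\<close> with \<open>w\<close> in \<open>W'\<close>. As \<open>g\<close> maps
    \<open>W'\<close> onto itself, \<open>?z\<close> is itself such a vector.\<close>
  have Pg: "P (g x) = g (P x)" if g: "g \<in> \<G>" for g x
  proof -
    let ?z = "P (g x) - g (P x)"
    have gP: "g (P x) \<in> W'" using P(2) W' g by (auto simp: invariant_def)
    then have z: "?z \<in> W'" using P(2) W' by (auto simp: invariant_def intro!: subspace_diff)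
    then obtain w where w: "w \<in> W'" "?z = g w" using image_G[OF W' g] by blast
    have "(g x - g (P x)) \<bullet> g w = 0"
      using P(3)[OF w(1)] inner_G[OF g] linear_diff[OF linear_G[OF g]] by metis
    moreover have "(g x - P (g x)) \<bullet> g w = 0" using P(3) w z by metis
    ultimately have "?z \<bullet> g w = 0" by (simp add: inner_diff_left)
    then have "?z \<bullet> ?z = 0" unfolding w(2) .
    then show ?thesis by simp
  qed
  have "linear (\<lambda>x. P (f x))" using linear_compose[OF assms(3) P(1)] by (simp add: o_def)
  moreover have "P (f (g x)) = g (P (f x))" if "g \<in> \<G>" "x \<in> W" for g x
    using that by (simp add: eq Pg)
  ultimately have "(\<forall>x\<in>W. P (f x) = 0) \<or> bij_betw (\<lambda>x. P (f x)) W W'"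
    using schur[OF assms(1,2), of "\<lambda>x. P (f x)"] P(2) by blast
  then show ?thesis
  proof
    assume 0: "\<forall>x\<in>W. P (f x) = 0"
    have "f x \<bullet> y = 0" if "x \<in> W" "y \<in> W'" for x y
      using P(3)[OF that(2), of "f x"] 0 that(1) by simp
    then show ?thesis by blast
  next
    assume "bij_betw (\<lambda>x. P (f x)) W W'"
    with \<open>linear (\<lambda>x. P (f x))\<close> eq Pg
    have "linear (\<lambda>x. P (f x)) \<and> bij_betw (\<lambda>x. P (f x)) W W' \<and>
        (\<forall>g\<in>\<G>. \<forall>x\<in>W. P (f (g x)) = g (P (f x)))" by simp
    then show ?thesis by blast
  qed
qed

end

section \<open>A self-adjoint intertwiner on the complement of its kernel\<close>

locale self_adjoint_intertwiner = orthogonal_rep A \<G>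
  for A :: "'e::euclidean_space set" and \<G> +
  fixes H :: "'e \<Rightarrow> 'e"
  assumes linear_H: "linear H"
    and H_A: "H ` A \<subseteq> A"
    and self_adjoint: "x \<in> A \<Longrightarrow> y \<in> A \<Longrightarrow> H x \<bullet> y = x \<bullet> H y"
    and H_G: "g \<in> \<G> \<Longrightarrow> x \<in> A \<Longrightarrow> H (g x) = g (H x)"
begin

definition kernel :: "'e set" where
  "kernel = {x \<in> A. H x = 0}"

definition kernel_perp :: "'e set" where
  "kernel_perp = {x \<in> A. \<forall>k\<in>kernel. x \<bullet> k = 0}"

definition kernel_perp_irreps :: "nat \<Rightarrow> 'e set set" where
  "kernel_perp_irreps d = {W. irreducible_rep W \<and> dim W = d \<and> W \<subseteq> kernel_perp}"

definition ranks :: "nat set" where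
  "ranks = {d. kernel_perp_irreps d \<noteq> {}}"

definition V :: "nat \<Rightarrow> 'e set" where
  "V d = span (\<Union>(kernel_perp_irreps d))"

lemma invariant_kernel: "invariant kernel"
  using subspace_A G_A linear_H
  by (auto simp: invariant_def kernel_def subspace_def linear_0 linear_add linear_scale H_G linear_G)

lemma invariant_kernel_perp: "invariant kernel_perp"
  unfolding kernel_perp_def by (rule invariant_complement[OF invariant_A invariant_kernel])

lemma subspace_kernel_perp: "subspace kernel_perp" and kernel_perp_A: "kernel_perp \<subseteq> A"
  and subspace_kernel: "subspace kernel" and kernel_A: "kernel \<subseteq> A"
  using invariant_kernel_perp invariant_kernel by (auto simp: invariant_def)

lemma H_kernel_perp: "H ` kernel_perp \<subseteq> kernel_perp"
proof clarify
  fix x assume x: "x \<in> kernel_perp"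
  then have "H x \<bullet> k = 0" if "k \<in> kernel" for k
    using self_adjoint[of x k] that by (auto simp: kernel_perp_def kernel_def)
  then show "H x \<in> kernel_perp" using x H_A by (auto simp: kernel_perp_def)
qed

lemma inj_on_kernel_perp: "inj_on H kernel_perp"
proof -
  have "x = 0" if "x \<in> kernel_perp" "H x = 0" for x
  proof -
    have "x \<in> kernel" using that by (auto simp: kernel_perp_def kernel_def)
    then have "x \<bullet> x = 0" using that by (auto simp: kernel_perp_def)
    then show ?thesis by simp
  qed
  then show ?thesis
    using linear_injective_on_subspace_0[OF linear_H subspace_kernel_perp] by blast
qed

lemma H_irreducible:
  assumes "irreducible_rep W" "W \<subseteq> kernel_perp"
  shows "irreducible_rep (H ` W)"
proof -
  have W: "invariant W" using assms by (simp add: irreducible_rep_def)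
  have inj: "inj_on H W" using inj_on_kernel_perp assms(2) inj_on_subset by blast
  have WA: "W \<subseteq> A" using W by (simp add: invariant_def)
  have "invariant (H ` W)"
    unfolding invariant_def
  proof (intro conjI ballI)
    show "subspace (H ` W)" using W linear_subspace_image[OF linear_H] by (simp add: invariant_def)
    show "H ` W \<subseteq> A" using WA H_A by blast
    fix g y assume g: "g \<in> \<G>" and "y \<in> H ` W"
    then obtain x where x: "x \<in> W" "y = H x" by blast
    then have "g y = H (g x)" "g x \<in> W" using H_G g W WA by (auto simp: invariant_def)
    then show "g y \<in> H ` W" by auto
  qed
  moreover have "H ` W \<noteq> {0}"
  proof
    assume *: "H ` W = {0}"
    have "0 \<in> W" using W by (simp add: invariant_def subspace_0)
    then have "W \<subseteq> {0}"
      using * inj_onD[OF inj] by (metis imageI insertI1 singletonD subsetI)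
    then show False using assms(1) \<open>0 \<in> W\<close> by (auto simp: irreducible_rep_def)
  qed
  moreover have "U = {0} \<or> U = H ` W" if U: "invariant U" "U \<subseteq> H ` W" for U
  proof -
    let ?U = "{x \<in> W. H x \<in> U}"
    have "invariant ?U"
      using U W WA linear_H
      by (auto simp: invariant_def subspace_def linear_0 linear_add linear_scale)
         (metis H_G subsetD)
    then have "?U = {0} \<or> ?U = W" using assms(1) by (auto simp: irreducible_rep_def)
    moreover have "U = H ` ?U" using U(2) by auto
    ultimately show ?thesis using linear_0[OF linear_H] by auto
  qed
  ultimately show ?thesis by (simp add: irreducible_rep_def)
qed

lemma subspace_V: "subspace (V d)"
  by (simp add: V_def)

lemma V_kernel_perp: "V d \<subseteq> kernel_perp"
  unfolding V_def by (intro span_minimal subspace_kernel_perp) (auto simp: kernel_perp_irreps_def)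

text \<open>\<open>H\<close> may carry an irreducible subspace to a different one of the same
  dimension, so what is preserved is the span of all of them, not each one.\<close>

lemma H_V: "H ` V d \<subseteq> V d"
proof -
  have "H ` W \<in> kernel_perp_irreps d" if "W \<in> kernel_perp_irreps d" for W
  proof -
    have W: "irreducible_rep W" "dim W = d" "W \<subseteq> kernel_perp" using that by (auto simp: kernel_perp_irreps_def)
    have "subspace W" using W by (simp add: irreducible_rep_def invariant_def)
    then have "dim (H ` W) = d"
      using W dim_image_eq[OF linear_H, of W] inj_on_subset[OF inj_on_kernel_perp] by (metis span_eq_iff)
    then show ?thesis using W H_irreducible H_kernel_perp by (auto simp: kernel_perp_irreps_def)
  qed
  then have "H ` \<Union>(kernel_perp_irreps d) \<subseteq> \<Union>(kernel_perp_irreps d)" by blast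
  then show ?thesis unfolding V_def using span_linear_image[OF linear_H] span_mono by metis
qed

lemma bij_V: "bij_betw H (V d) (V d)"
proof -
  have inj: "inj_on H (V d)" using inj_on_kernel_perp V_kernel_perp inj_on_subset by blast
  have "dim (H ` V d) = dim (V d)"
    using dim_image_eq[OF linear_H, of "V d"] inj subspace_V by (metis span_eq_iff)
  then have "H ` V d = V d"
    using H_V linear_subspace_image[OF linear_H] subspace_V by (intro subspace_dim_equal) auto
  then show ?thesis using inj by (simp add: bij_betw_def)
qed

text \<open>An isomorphism would preserve dimension, so for different ranks only the orthogonal
  alternative remains. Within one \<open>V d\<close> the summands may be isomorphic or not.\<close>

lemma orthogonal_V:
  assumes "d \<noteq> d'" "x \<in> V d" "y \<in> V d'"
  shows "x \<bullet> y = 0"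
proof -
  have "x \<bullet> y = 0" if xy: "x \<in> W" "y \<in> W'" and "W \<in> kernel_perp_irreps d" "W' \<in> kernel_perp_irreps d'" for x y W W'
  proof (rule ccontr)
    assume "x \<bullet> y \<noteq> 0"
    have W: "irreducible_rep W" "dim W = d" and W': "irreducible_rep W'" "dim W' = d'"
      using that by (auto simp: kernel_perp_irreps_def)
    then obtain h where h: "linear h" "bij_betw h W W'"
      using orthogonal_or_isomorphic[OF W(1) W'(1) linear_id] \<open>x \<bullet> y \<noteq> 0\<close> xy by (metis id_apply)
    have "subspace W" using W by (simp add: irreducible_rep_def invariant_def)
    then have "dim (h ` W) = dim W"
      using dim_image_eq[OF h(1), of W] h(2) by (metis bij_betw_def span_eq_iff)
    moreover have "h ` W = W'" using h(2) by (simp add: bij_betw_def)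
    ultimately show False using W(2) W'(2) assms(1) by metis
  qed
  then have "x \<bullet> y = 0" if "x \<in> \<Union>(kernel_perp_irreps d)" "y \<in> \<Union>(kernel_perp_irreps d')" for x y
    using that by blast
  then show ?thesis
    using assms(2,3) unfolding V_def by (rule orthogonal_to_spans)
qed

lemma finite_ranks: "finite ranks"
proof -
  have "ranks \<subseteq> {..DIM('e)}"
    using dim_subset_UNIV by (auto simp: ranks_def kernel_perp_irreps_def)
  then show ?thesis using finite_subset by blast
qed

lemma span_V: "span (\<Union>d\<in>ranks. V d) = kernel_perp"
proof
  show "span (\<Union>d\<in>ranks. V d) \<subseteq> kernel_perp"
    using V_kernel_perp by (intro span_minimal subspace_kernel_perp) auto
  have "W \<subseteq> (\<Union>d\<in>ranks. V d)" if "irreducible_rep W" "W \<subseteq> kernel_perp" for W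
  proof -
    have "W \<in> kernel_perp_irreps (dim W)" using that by (simp add: kernel_perp_irreps_def)
    then have "dim W \<in> ranks" "W \<subseteq> V (dim W)"
      by (auto simp: ranks_def V_def intro: span_base)
    then show ?thesis by blast
  qed
  then have "span (\<Union>{U. irreducible_rep U \<and> U \<subseteq> kernel_perp}) \<subseteq> span (\<Union>d\<in>ranks. V d)"
    by (intro span_mono) blast
  then show "kernel_perp \<subseteq> span (\<Union>d\<in>ranks. V d)"
    using completely_reducible[OF invariant_kernel_perp] by simp
qed

text \<open>An irreducible real representation can have endomorphisms that are not scalars, its
  commutant being possibly the complex numbers or the quaternions; self-adjointness is what supplies
  a real eigenvector. Orthogonality of the summands is stated as well because the sum formula for
  the flux form relies on it.\<close>

lemma eigenvalue_of_multiplicity_free: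
  assumes irr: "\<forall>j\<in>I. irreducible_rep (W j)"
    and noniso: "\<forall>i\<in>I. \<forall>j\<in>I. i \<noteq> j \<longrightarrow>
      \<not> (\<exists>h. linear h \<and> bij_betw h (W i) (W j) \<and> (\<forall>g\<in>\<G>. \<forall>x\<in>W i. h (g x) = g (h x)))"
    and span: "span (\<Union>j\<in>I. W j) = kernel_perp"
  shows "i \<in> I \<Longrightarrow> j \<in> I \<Longrightarrow> i \<noteq> j \<Longrightarrow> x \<in> W i \<Longrightarrow> y \<in> W j \<Longrightarrow> x \<bullet> y = 0"
    and "j \<in> I \<Longrightarrow> \<exists>a. a \<noteq> 0 \<and> (\<forall>x\<in>W j. H x = a *\<^sub>R x)"
proof -
  show orth: "x \<bullet> y = 0" if "i \<in> I" "j \<in> I" "i \<noteq> j" "x \<in> W i" "y \<in> W j" for i j x y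
    using orthogonal_or_isomorphic[OF irr[rule_format, OF that(1)] irr[rule_format, OF that(2)] linear_id]
      noniso[rule_format, OF that(1-3)] that(4,5) by simp
  show "\<exists>a. a \<noteq> 0 \<and> (\<forall>x\<in>W j. H x = a *\<^sub>R x)" if j: "j \<in> I"
  proof -
    have inv: "invariant (W j)" using irr[rule_format, OF j] by (simp add: irreducible_rep_def)
    then have sub: "subspace (W j)" and WA: "W j \<subseteq> A" by (auto simp: invariant_def)
    have Wc: "W j \<subseteq> kernel_perp" using span j span_superset[of "\<Union>j\<in>I. W j"] by blast
    have HG: "H (g x) = g (H x)" if "g \<in> \<G>" "x \<in> W j" for g x
      using H_G that WA by blast
    have Horth: "H x \<bullet> y = 0" if "i \<in> I" "i \<noteq> j" "x \<in> W j" "y \<in> W i" for i x y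
      using orthogonal_or_isomorphic[OF irr[rule_format, OF j] irr[rule_format, OF that(1)] linear_H HG]
        noniso[rule_format, OF j that(1) that(2)[symmetric]] that(3,4) by blast
    have HW: "H ` W j \<subseteq> W j"
    proof clarify
      fix x assume x: "x \<in> W j"
      define P where "P = projection (W j)"
      note P = projection_in[OF sub, folded P_def] projection_orthogonal[OF sub, folded P_def]
      \<comment> \<open>\<open>?z\<close> is the part of \<open>H x\<close> outside
        \<open>W j\<close>. It is orthogonal to each \<open>W i\<close>, hence to their span
        \<open>kernel_perp\<close>, to which it belongs.\<close>
      let ?z = "H x - P (H x)"
      have "?z \<bullet> w = 0" if "i \<in> I" "w \<in> W i" for i w
      proof (cases "i = j")
        case True
        then show ?thesis using P(2) that by simp
      next
        case False
        then have "H x \<bullet> w = 0" "P (H x) \<bullet> w = 0"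
          using Horth[OF that(1) _ x that(2)] orth[OF j that(1) _ P(1) that(2)] by auto
        then show ?thesis by (simp add: inner_diff_left)
      qed
      then have "u \<bullet> w = 0" if "u \<in> {?z}" "w \<in> (\<Union>j\<in>I. W j)" for u w
        using that by blast
      then have "u \<bullet> w = 0" if "u \<in> span {?z}" "w \<in> span (\<Union>j\<in>I. W j)" for u w
        using that by (rule orthogonal_to_spans)
      moreover have "?z \<in> kernel_perp"
        using x Wc H_kernel_perp P(1) by (intro subspace_diff[OF subspace_kernel_perp]) auto
      ultimately have "?z \<bullet> ?z = 0" unfolding span by (meson insertI1 span_base)
      then show "H x \<in> W j" using P(1)[of "H x"] by simp
    qed
    obtain a x where x: "x \<in> W j" "x \<noteq> 0" "H x = a *\<^sub>R x"
      using self_adjoint_eigenvector[OF linear_H sub _ HW] self_adjoint WA irr[rule_format, OF j]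
      unfolding irreducible_rep_def by (metis subsetD)
    let ?E = "{x \<in> W j. H x = a *\<^sub>R x}"
    have "invariant ?E"
      using inv linear_H
      by (auto simp: invariant_def subspace_def linear_0 linear_add linear_scale HG linear_G
          scaleR_add_right)
    then have "?E = W j" using irr[rule_format, OF j] x by (auto simp: irreducible_rep_def)
    moreover have "a \<noteq> 0"
    proof
      assume "a = 0"
      then have "H x = H 0" using x linear_0[OF linear_H] by simp
      then show False using inj_onD[OF inj_on_kernel_perp, of x 0] x Wc subspace_0[OF subspace_kernel_perp] by auto
    qed
    ultimately show ?thesis by blast
  qed
qed

end

text \<open>Connects the indexed sums in \<open>is_direct_sum\<close> with spans, the form in which
  the representation theory delivers its decompositions.\<close>

lemma sum_of_subspaces_eq_span:
  fixes U :: "'i \<Rightarrow> 'v::real_vector set"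
  assumes "finite I" "\<And>i. i \<in> I \<Longrightarrow> subspace (U i)"
  shows "{\<Sum>i\<in>I. x i | x. \<forall>i\<in>I. x i \<in> U i} = span (\<Union>i\<in>I. U i)" (is "?S = _")
proof
  have "subspace ?S"
  proof (rule subspaceI)
    show "0 \<in> ?S" using assms(2) by (auto intro!: exI[of _ "\<lambda>_. 0"] simp: subspace_0)
    fix x y assume "x \<in> ?S" "y \<in> ?S"
    then obtain u v where uv: "x = sum u I" "y = sum v I" "\<forall>i\<in>I. u i \<in> U i" "\<forall>i\<in>I. v i \<in> U i" by auto
    then have "x + y = (\<Sum>i\<in>I. u i + v i)" "\<forall>i\<in>I. u i + v i \<in> U i"
      using assms(2) by (auto simp: sum.distrib subspace_add)
    then show "x + y \<in> ?S" by blast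
  next
    fix c :: real and x assume "x \<in> ?S"
    then obtain u where u: "x = sum u I" "\<forall>i\<in>I. u i \<in> U i" by auto
    then have "c *\<^sub>R x = (\<Sum>i\<in>I. c *\<^sub>R u i)" "\<forall>i\<in>I. c *\<^sub>R u i \<in> U i"
      using assms(2) by (auto simp: scaleR_sum_right subspace_scale)
    then show "c *\<^sub>R x \<in> ?S" by blast
  qed
  moreover have "(\<Union>i\<in>I. U i) \<subseteq> ?S"
  proof clarify
    fix i x assume i: "i \<in> I" "x \<in> U i"
    then have "x = (\<Sum>j\<in>I. if j = i then x else 0)" using assms(1) by simp
    moreover have "\<forall>j\<in>I. (if j = i then x else 0) \<in> U j" using i assms(2) by (auto simp: subspace_0)
    ultimately show "\<exists>u. x = sum u I \<and> (\<forall>j\<in>I. u j \<in> U j)" by blast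
  qed
  ultimately show "span (\<Union>i\<in>I. U i) \<subseteq> ?S" by (rule span_minimal[rotated])
  show "?S \<subseteq> span (\<Union>i\<in>I. U i)"
  proof clarify
    fix x assume "\<forall>i\<in>I. x i \<in> U i"
    then show "sum x I \<in> span (\<Union>i\<in>I. U i)" by (intro span_sum) (auto intro: span_base)
  qed
qed

lemma orthogonal_is_direct_sum:
  fixes U :: "'i \<Rightarrow> 'e::real_inner set"
  assumes "finite I" "\<And>i. i \<in> I \<Longrightarrow> subspace (U i)"
    and orth: "\<And>i j x y. \<lbrakk>i \<in> I; j \<in> I; i \<noteq> j; x \<in> U i; y \<in> U j\<rbrakk> \<Longrightarrow> x \<bullet> y = 0"
    and "span (\<Union>i\<in>I. U i) = V"
  shows "is_direct_sum I U V"
  unfolding is_direct_sum_def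
proof (intro conjI ballI allI impI)
  fix x i assume x: "(\<forall>i\<in>I. x i \<in> U i) \<and> sum x I = 0" and i: "i \<in> I"
  have "0 = x i \<bullet> sum x I" using x by simp
  also have "\<dots> = (\<Sum>j\<in>I. if j = i then x i \<bullet> x i else 0)"
    unfolding inner_sum_right
  proof (rule sum.cong[OF refl])
    fix j assume "j \<in> I"
    then show "x i \<bullet> x j = (if j = i then x i \<bullet> x i else 0)"
      using x i orth[of i j "x i" "x j"] by auto
  qed
  finally show "x i = 0" using assms(1) i by simp
next
  show "V = {\<Sum>i\<in>I. x i | x. \<forall>i\<in>I. x i \<in> U i}"
    using assms(1,2) by (subst sum_of_subspaces_eq_span) (simp_all add: assms(4))
qed (use assms in simp_all)

lemma is_direct_sum_span:
  assumes "is_direct_sum I U V"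
  shows "span (\<Union>i\<in>I. U i) = V"
proof -
  have "finite I" "\<And>i. i \<in> I \<Longrightarrow> subspace (U i)" "V = {\<Sum>i\<in>I. x i | x. \<forall>i\<in>I. x i \<in> U i}"
    using assms by (simp_all add: is_direct_sum_def)
  then show ?thesis using sum_of_subspaces_eq_span[of I U] by simp
qed

lemma is_direct_sum_linear_image:
  assumes "linear f" "inj_on f V" "subspace V" "is_direct_sum I U V"
  shows "is_direct_sum I (\<lambda>i. f ` U i) (f ` V)"
proof -
  have fin: "finite I" and sub: "\<And>i. i \<in> I \<Longrightarrow> subspace (U i)"
    and V: "V = {\<Sum>i\<in>I. x i | x. \<forall>i\<in>I. x i \<in> U i}"
    and ind: "\<And>x. (\<forall>i\<in>I. x i \<in> U i) \<Longrightarrow> (\<Sum>i\<in>I. x i) = 0 \<Longrightarrow> (\<forall>i\<in>I. x i = 0)"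
    using assms(4) by (auto simp: is_direct_sum_def)
  have lift: "\<exists>u. (\<forall>i\<in>I. u i \<in> U i \<and> x i = f (u i))" if "\<forall>i\<in>I. x i \<in> f ` U i" for x
  proof -
    have "\<forall>i\<in>I. \<exists>u. u \<in> U i \<and> x i = f u" using that by blast
    then show ?thesis by metis
  qed
  have "f ` V = {\<Sum>i\<in>I. x i | x. \<forall>i\<in>I. x i \<in> f ` U i}"
  proof
    show "f ` V \<subseteq> {\<Sum>i\<in>I. x i | x. \<forall>i\<in>I. x i \<in> f ` U i}"
      unfolding V by (auto simp: linear_sum[OF assms(1)])
    show "{\<Sum>i\<in>I. x i | x. \<forall>i\<in>I. x i \<in> f ` U i} \<subseteq> f ` V"
    proof clarify
      fix x assume "\<forall>i\<in>I. x i \<in> f ` U i"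
      then obtain u where u: "\<forall>i\<in>I. u i \<in> U i \<and> x i = f (u i)" using lift by blast
      then have "sum x I = f (sum u I)" by (simp add: linear_sum[OF assms(1)])
      moreover have "sum u I \<in> V" unfolding V using u by auto
      ultimately show "sum x I \<in> f ` V" by blast
    qed
  qed
  moreover have "\<forall>i\<in>I. x i = 0" if x: "\<forall>i\<in>I. x i \<in> f ` U i" "sum x I = 0" for x
  proof -
    obtain u where u: "\<forall>i\<in>I. u i \<in> U i \<and> x i = f (u i)" using lift x by blast
    then have "f (sum u I) = 0" using x(2) by (simp add: linear_sum[OF assms(1)])
    moreover have "sum u I \<in> V" unfolding V using u by auto
    ultimately have "sum u I = 0"
      using linear_injective_on_subspace_0[OF assms(1,3)] assms(2) by blast
    then have "\<forall>i\<in>I. u i = 0" using ind u by blast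
    then show ?thesis using u linear_0[OF assms(1)] by simp
  qed
  ultimately show ?thesis
    using fin sub linear_subspace_image[OF assms(1)] by (auto simp: is_direct_sum_def)
qed

section \<open>Alternating 3-forms and their components\<close>

lemma alt_forms_support:
  "\<omega> \<in> alt_forms T q \<Longrightarrow> \<not> (length vs = q \<and> set vs \<subseteq> T) \<Longrightarrow> \<omega> vs = 0"
  unfolding alt_forms_def by blast

lemma alt_forms_linear:
  "\<omega> \<in> alt_forms T q \<Longrightarrow> length vs = q \<Longrightarrow> set vs \<subseteq> T \<Longrightarrow> i < q \<Longrightarrow> x \<in> T \<Longrightarrow> y \<in> T \<Longrightarrow>
    \<omega> (vs[i := a *\<^sub>R x + b *\<^sub>R y]) = a * \<omega> (vs[i := x]) + b * \<omega> (vs[i := y])"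
  unfolding alt_forms_def by blast

lemma alt_forms_repeat:
  "\<omega> \<in> alt_forms T q \<Longrightarrow> length vs = q \<Longrightarrow> set vs \<subseteq> T \<Longrightarrow> i < q \<Longrightarrow> j < q \<Longrightarrow> i \<noteq> j \<Longrightarrow>
    vs ! i = vs ! j \<Longrightarrow> \<omega> vs = 0"
  unfolding alt_forms_def by blast

lemma alt_forms_sum:
  assumes "\<omega> \<in> alt_forms T q" "subspace T" "length vs = q" "set vs \<subseteq> T" "i < q"
    and "finite S" "\<And>k. k \<in> S \<Longrightarrow> u k \<in> T"
  shows "\<omega> (vs[i := \<Sum>k\<in>S. c k *\<^sub>R u k]) = (\<Sum>k\<in>S. c k * \<omega> (vs[i := u k]))"
  using assms(6,7)
proof (induction S rule: finite_induct)
  case empty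
  have "0 \<in> T" using assms(2) by (rule subspace_0)
  then show ?case using alt_forms_linear[OF assms(1,3,4,5), of 0 0 0 0] by simp
next
  case (insert k S)
  have "(\<Sum>k\<in>S. c k *\<^sub>R u k) \<in> T"
    using insert.prems by (intro subspace_sum[OF assms(2)] subspace_scale[OF assms(2)]) auto
  with insert show ?case
    using alt_forms_linear[OF assms(1,3,4,5), of "u k" "\<Sum>k\<in>S. c k *\<^sub>R u k" "c k" 1] by simp
qed

text \<open>Polarisation: expanding the vanishing value with \<open>x + y\<close> in both slots
  leaves only the two mixed terms.\<close>

lemma alt_forms_swap:
  assumes "\<omega> \<in> alt_forms T q" "subspace T" "length vs = q" "set vs \<subseteq> T" "i < q" "j < q" "i \<noteq> j"
    and "x \<in> T" "y \<in> T"
  shows "\<omega> (vs[i := x, j := y]) = - \<omega> (vs[i := y, j := x])"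
proof -
  have upd: "set (vs[i := u, j := v]) \<subseteq> T" "set (vs[i := u]) \<subseteq> T"
    if "u \<in> T" "v \<in> T" for u v
    using that assms(4) set_update_subset_insert by (metis insert_subset order.trans)+
  have xy: "x + y \<in> T" using assms(2,8,9) by (rule subspace_add)
  have diag: "\<omega> (vs[i := u, j := u]) = 0" if "u \<in> T" for u
    using assms upd[OF that that] by (intro alt_forms_repeat[OF assms(1), of _ i j]) auto
  have second: "\<omega> (vs[i := u, j := x + y]) = \<omega> (vs[i := u, j := x]) + \<omega> (vs[i := u, j := y])" if "u \<in> T" for u
    using alt_forms_linear[OF assms(1), of "vs[i := u]" j x y 1 1] assms upd(2)[OF that that] by simp
  have first: "\<omega> (vs[i := x + y, j := u]) = \<omega> (vs[i := x, j := u]) + \<omega> (vs[i := y, j := u])" if "u \<in> T" for u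
  proof -
    have "set (vs[j := u]) \<subseteq> T" using that assms(4) set_update_subset_insert by (metis insert_subset order.trans)
    then show ?thesis
      using alt_forms_linear[OF assms(1), of "vs[j := u]" i x y 1 1] assms
      by (simp add: list_update_swap[of i j])
  qed
  show ?thesis
    using diag[OF xy] second[OF xy] first[OF assms(8)] first[OF assms(9)] diag[OF assms(8)] diag[OF assms(9)]
    by simp
qed

text \<open>No membership in \<open>T\<close> is asked of the arguments: a permuted list leaves
  \<open>T\<close> together with the original, and both values are then zero. Later rewriting with
  these rules is thus unconditional.\<close>

lemma alt_forms_swap3:
  assumes "\<omega> \<in> alt_forms T 3" "subspace T"
  shows "\<omega> [x, y, z] = - \<omega> [y, x, z]" "\<omega> [x, y, z] = - \<omega> [x, z, y]"
proof -
  show "\<omega> [x, y, z] = - \<omega> [y, x, z]"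
  proof (cases "set [x, y, z] \<subseteq> T")
    case True
    then show ?thesis using alt_forms_swap[OF assms, of "[x, y, z]" 0 1 x y] by simp
  next
    case False
    then show ?thesis using alt_forms_support[OF assms(1), of "[x, y, z]"]
        alt_forms_support[OF assms(1), of "[y, x, z]"] by auto
  qed
  show "\<omega> [x, y, z] = - \<omega> [x, z, y]"
  proof (cases "set [x, y, z] \<subseteq> T")
    case True
    then show ?thesis using alt_forms_swap[OF assms, of "[x, y, z]" 1 2 y z] by (simp add: numeral_2_eq_2)
  next
    case False
    then show ?thesis using alt_forms_support[OF assms(1), of "[x, y, z]"]
        alt_forms_support[OF assms(1), of "[x, z, y]"] by auto
  qed
qed

lemma alt_forms_swap4:
  assumes "\<omega> \<in> alt_forms T 4" "subspace T"
  shows "\<omega> [x, y, z, w] = - \<omega> [y, x, z, w]" "\<omega> [x, y, z, w] = - \<omega> [x, z, y, w]"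
    "\<omega> [x, y, z, w] = - \<omega> [x, y, w, z]"
proof -
  note off = alt_forms_support[OF assms(1)]
  show "\<omega> [x, y, z, w] = - \<omega> [y, x, z, w]"
    using alt_forms_swap[OF assms, of "[x, y, z, w]" 0 1 x y]
      off[of "[x, y, z, w]"] off[of "[y, x, z, w]"]
    by (cases "set [x, y, z, w] \<subseteq> T") auto
  show "\<omega> [x, y, z, w] = - \<omega> [x, z, y, w]"
    using alt_forms_swap[OF assms, of "[x, y, z, w]" 1 2 y z]
      off[of "[x, y, z, w]"] off[of "[x, z, y, w]"]
    by (cases "set [x, y, z, w] \<subseteq> T") (auto simp: numeral_2_eq_2)
  show "\<omega> [x, y, z, w] = - \<omega> [x, y, w, z]"
    using alt_forms_swap[OF assms, of "[x, y, z, w]" 2 3 z w]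
      off[of "[x, y, z, w]"] off[of "[x, y, w, z]"]
    by (cases "set [x, y, z, w] \<subseteq> T") (auto simp: numeral_2_eq_2 numeral_3_eq_3)
qed

lemma length_3_cases: "length vs = 3 \<Longrightarrow> \<exists>x y z. vs = [x, y, z]"
  by (auto simp: length_Suc_conv numeral_3_eq_3)

text \<open>The two adjacent transpositions carry linearity from the first slot to the others, and a
  repeated argument gives a value equal to its own negative.\<close>

lemma alt_forms_3I:
  assumes supp: "\<And>vs. \<not> (length vs = 3 \<and> set vs \<subseteq> T) \<Longrightarrow> \<omega> vs = 0"
    and swap: "\<And>x y z. \<omega> [x, y, z] = - \<omega> [y, x, z]" "\<And>x y z. \<omega> [x, y, z] = - \<omega> [x, z, y]"
    and lin: "\<And>x x' y z a b. \<lbrakk>x \<in> T; x' \<in> T; y \<in> T; z \<in> T\<rbrakk> \<Longrightarrow>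
      \<omega> [a *\<^sub>R x + b *\<^sub>R x', y, z] = a * \<omega> [x, y, z] + b * \<omega> [x', y, z]"
  shows "\<omega> \<in> alt_forms T 3"
  unfolding alt_forms_def
proof (intro CollectI conjI allI impI; (elim conjE)?)
  fix vs :: "'a list" and i :: nat and x y a b
  assume vs: "length vs = 3" "set vs \<subseteq> T" and i: "i < 3" and xy: "x \<in> T" "y \<in> T"
  obtain u v w where uvw: "vs = [u, v, w]" using length_3_cases[OF vs(1)] by blast
  have T: "u \<in> T" "v \<in> T" "w \<in> T" using vs(2) uvw by auto
  consider "i = 0" | "i = 1" | "i = 2" using i by linarith
  then show "\<omega> (vs[i := a *\<^sub>R x + b *\<^sub>R y]) = a * \<omega> (vs[i := x]) + b * \<omega> (vs[i := y])"
  proof cases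
    case 1 then show ?thesis using lin xy T uvw by simp
  next
    case 2
    have "\<omega> [u, t, w] = - \<omega> [t, u, w]" for t by (rule swap(1))
    then show ?thesis using 2 lin[OF xy T(1,3)] uvw by simp
  next
    case 3
    have "\<omega> [u, v, t] = \<omega> [t, u, v]" for t using swap(2)[of u v t] swap(1)[of u t v] by simp
    then show ?thesis using 3 lin[OF xy T(1,2)] uvw by (simp add: numeral_2_eq_2)
  qed
next
  fix vs :: "'a list" and i j :: nat
  assume vs: "length vs = 3" "set vs \<subseteq> T" and ij: "i < 3" "j < 3" "i \<noteq> j" and eq: "vs ! i = vs ! j"
  obtain u v w where uvw: "vs = [u, v, w]" using length_3_cases[OF vs(1)] by blast
  have "i = 0 \<or> i = 1 \<or> i = 2" "j = 0 \<or> j = 1 \<or> j = 2" using ij by linarith+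
  then have "u = v \<or> v = w \<or> u = w" using ij(3) eq uvw by (auto simp: numeral_2_eq_2)
  moreover have "\<omega> [u, v, u] = 0" using swap(2)[of u v u] swap(1)[of u u v] by simp
  ultimately show "\<omega> vs = 0" using swap(1)[of u u w] swap(2)[of u v v] uvw by auto
qed (use supp in blast)

section \<open>Component arrays, change of frame and reconstruction of forms\<close>

definition frame_components :: "('n::finite \<Rightarrow> 'v) \<Rightarrow> 'v form \<Rightarrow> real^'n^'n^'n" where
  "frame_components e \<omega> = (\<chi> i j k. \<omega> [e i, e j, e k])"

definition alternating_arrays :: "(real^'n^'n^'n) set" where
  "alternating_arrays = {x. \<forall>i j k. x$i$j$k + x$j$i$k = 0 \<and> x$i$j$k + x$i$k$j = 0}"

text \<open>The rule by which components of a 3-form change when the frame is multiplied by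
  \<open>Q\<close>. The sums are nested, not multiplied out, so that one index can be contracted at
  a time.\<close>

definition transform_array :: "real^'n^'n \<Rightarrow> real^'n^'n^'n \<Rightarrow> real^'n^'n^'n" where
  "transform_array Q x = (\<chi> a b c. \<Sum>i\<in>UNIV. Q$i$a * (\<Sum>j\<in>UNIV. Q$j$b * (\<Sum>k\<in>UNIV. Q$k$c * x$i$j$k)))"

lemma linear_components: "linear (frame_components e)"
  by (rule linearI) (simp_all add: frame_components_def vec_eq_iff plus_fun_def scaleR_fun_def)

lemma linear_transform_array: "linear (transform_array Q)"
  by (rule linearI)
     (simp_all add: transform_array_def vec_eq_iff sum.distrib sum_distrib_left algebra_simps)

lemma alternating_arraysD:
  assumes "x \<in> alternating_arrays"
  shows "x$i$j$k = - x$j$i$k" "x$i$j$k = - x$i$k$j"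
  using assms unfolding alternating_arrays_def by (auto simp: eq_neg_iff_add_eq_0)

lemma subspace_alternating_arrays: "subspace alternating_arrays"
proof (rule subspaceI)
  show "0 \<in> alternating_arrays" by (simp add: alternating_arrays_def)
  fix x y :: "real^'n^'n^'n" assume xy: "x \<in> alternating_arrays" "y \<in> alternating_arrays"
  have "(x + y)$i$j$k + (x + y)$j$i$k = 0 \<and> (x + y)$i$j$k + (x + y)$i$k$j = 0" for i j k
    using alternating_arraysD[OF xy(1), of i j k] alternating_arraysD[OF xy(2), of i j k] by simp
  then show "x + y \<in> alternating_arrays" unfolding alternating_arrays_def by blast
next
  fix c and x :: "real^'n^'n^'n" assume x: "x \<in> alternating_arrays"
  have "(c *\<^sub>R x)$i$j$k + (c *\<^sub>R x)$j$i$k = 0 \<and> (c *\<^sub>R x)$i$j$k + (c *\<^sub>R x)$i$k$j = 0" for i j k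
    using alternating_arraysD[OF x, of i j k] by simp
  then show "c *\<^sub>R x \<in> alternating_arrays" unfolding alternating_arrays_def by blast
qed

lemma inner_array: "x \<bullet> y = (\<Sum>i\<in>UNIV. \<Sum>j\<in>UNIV. \<Sum>k\<in>UNIV. x$i$j$k * y$i$j$k)"
  for x y :: "real^'n^'n^'n"
  by (simp add: inner_vec_def)

text \<open>The rows of \<open>Q\<close> are orthonormal. This one contraction yields both the
  invariance of the inner product of arrays and the independence of the flux operator from the
  orthonormal frame.\<close>

lemma orthogonal_matrix_sum:
  fixes Q :: "real^'n^'n"
  assumes "orthogonal_matrix Q"
  shows "(\<Sum>a\<in>UNIV. (\<Sum>i\<in>UNIV. Q$i$a * f i) * (\<Sum>i\<in>UNIV. Q$i$a * g i)) = (\<Sum>i\<in>UNIV. f i * g i)"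
proof -
  have Q: "(\<Sum>a\<in>UNIV. Q$i$a * Q$j$a) = (if i = j then 1 else 0)" for i j
  proof -
    have "Q ** transpose Q = mat 1" using assms by (simp add: orthogonal_matrix_def)
    then have "(Q ** transpose Q) $ i $ j = mat 1 $ i $ j" by simp
    then show ?thesis by (simp add: matrix_matrix_mult_def transpose_def mat_def)
  qed
  have "(\<Sum>a\<in>UNIV. (\<Sum>i\<in>UNIV. Q$i$a * f i) * (\<Sum>j\<in>UNIV. Q$j$a * g j))
      = (\<Sum>a\<in>UNIV. \<Sum>i\<in>UNIV. \<Sum>j\<in>UNIV. f i * g j * (Q$i$a * Q$j$a))"
    by (simp add: sum_product algebra_simps)
  also have "\<dots> = (\<Sum>i\<in>UNIV. \<Sum>a\<in>UNIV. \<Sum>j\<in>UNIV. f i * g j * (Q$i$a * Q$j$a))"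
    by (rule sum.swap)
  also have "\<dots> = (\<Sum>i\<in>UNIV. \<Sum>j\<in>UNIV. \<Sum>a\<in>UNIV. f i * g j * (Q$i$a * Q$j$a))"
    by (intro sum.cong refl sum.swap)
  also have "\<dots> = (\<Sum>i\<in>UNIV. \<Sum>j\<in>UNIV. f i * g j * (if i = j then 1 else 0))"
    by (simp only: Q flip: sum_distrib_left)
  also have "\<dots> = (\<Sum>i\<in>UNIV. f i * g i)"
    by (simp add: if_distrib cong: if_cong)
  finally show ?thesis .
qed

text \<open>Each of the three indices is moved innermost in turn, where
  \<open>orthogonal_matrix_sum\<close> removes the matrix \<open>Q\<close>.\<close>

lemma inner_transform_array:
  assumes "orthogonal_matrix Q"
  shows "transform_array Q x \<bullet> transform_array Q y = x \<bullet> y"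
proof -
  note orth = orthogonal_matrix_sum[OF assms]
  let ?x2 = "\<lambda>i b c. \<Sum>j\<in>UNIV. Q$j$b * (\<Sum>k\<in>UNIV. Q$k$c * x$i$j$k)"
  let ?y2 = "\<lambda>i b c. \<Sum>j\<in>UNIV. Q$j$b * (\<Sum>k\<in>UNIV. Q$k$c * y$i$j$k)"
  let ?x1 = "\<lambda>i j c. \<Sum>k\<in>UNIV. Q$k$c * x$i$j$k"
  let ?y1 = "\<lambda>i j c. \<Sum>k\<in>UNIV. Q$k$c * y$i$j$k"
  have "transform_array Q x \<bullet> transform_array Q y =
      (\<Sum>a\<in>UNIV. \<Sum>b\<in>UNIV. \<Sum>c\<in>UNIV. (\<Sum>i\<in>UNIV. Q$i$a * ?x2 i b c) * (\<Sum>i\<in>UNIV. Q$i$a * ?y2 i b c))"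
    by (simp add: inner_array transform_array_def)
  also have "\<dots> = (\<Sum>b\<in>UNIV. \<Sum>a\<in>UNIV. \<Sum>c\<in>UNIV. (\<Sum>i\<in>UNIV. Q$i$a * ?x2 i b c) * (\<Sum>i\<in>UNIV. Q$i$a * ?y2 i b c))"
    by (rule sum.swap)
  also have "\<dots> = (\<Sum>b\<in>UNIV. \<Sum>c\<in>UNIV. \<Sum>a\<in>UNIV. (\<Sum>i\<in>UNIV. Q$i$a * ?x2 i b c) * (\<Sum>i\<in>UNIV. Q$i$a * ?y2 i b c))"
    by (intro sum.cong refl sum.swap)
  also have "\<dots> = (\<Sum>b\<in>UNIV. \<Sum>c\<in>UNIV. \<Sum>i\<in>UNIV. ?x2 i b c * ?y2 i b c)"
    by (simp only: orth)
  also have "\<dots> = (\<Sum>b\<in>UNIV. \<Sum>i\<in>UNIV. \<Sum>c\<in>UNIV. ?x2 i b c * ?y2 i b c)"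
    by (intro sum.cong refl sum.swap)
  also have "\<dots> = (\<Sum>i\<in>UNIV. \<Sum>b\<in>UNIV. \<Sum>c\<in>UNIV. ?x2 i b c * ?y2 i b c)"
    by (rule sum.swap)
  also have "\<dots> = (\<Sum>i\<in>UNIV. \<Sum>c\<in>UNIV. \<Sum>b\<in>UNIV. ?x2 i b c * ?y2 i b c)"
    by (intro sum.cong refl sum.swap)
  also have "\<dots> = (\<Sum>i\<in>UNIV. \<Sum>c\<in>UNIV. \<Sum>j\<in>UNIV. ?x1 i j c * ?y1 i j c)"
    by (simp only: orth)
  also have "\<dots> = (\<Sum>i\<in>UNIV. \<Sum>j\<in>UNIV. \<Sum>c\<in>UNIV. ?x1 i j c * ?y1 i j c)"
    by (intro sum.cong refl sum.swap)
  also have "\<dots> = x \<bullet> y"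
    by (simp only: orth inner_array)
  finally show ?thesis .
qed

lemma components_frame_act:
  assumes "\<omega> \<in> alt_forms T 3" "subspace T" "\<And>i. e i \<in> T"
  shows "frame_components (frame_act e Q) \<omega> = transform_array Q (frame_components e \<omega>)"
proof -
  note exp = alt_forms_sum[OF assms(1,2)]
  have fT: "frame_act e Q i \<in> T" for i
    unfolding frame_act_def using assms(3) by (intro subspace_sum[OF assms(2)] subspace_scale[OF assms(2)]) auto
  have "\<omega> [frame_act e Q a, frame_act e Q b, frame_act e Q c] =
      (\<Sum>i\<in>UNIV. Q$i$a * (\<Sum>j\<in>UNIV. Q$j$b * (\<Sum>k\<in>UNIV. Q$k$c * \<omega> [e i, e j, e k])))" for a b c
  proof -
    have "\<omega> [frame_act e Q a, frame_act e Q b, frame_act e Q c] =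
        (\<Sum>i\<in>UNIV. Q$i$a * \<omega> [e i, frame_act e Q b, frame_act e Q c])"
      using exp[of "[e a, frame_act e Q b, frame_act e Q c]" 0 UNIV e "\<lambda>i. Q$i$a"] assms(3) fT
      by (simp add: frame_act_def)
    also have "\<dots> = (\<Sum>i\<in>UNIV. Q$i$a * (\<Sum>j\<in>UNIV. Q$j$b * \<omega> [e i, e j, frame_act e Q c]))"
      using exp[of "[e i, e b, frame_act e Q c]" 1 UNIV e "\<lambda>j. Q$j$b" for i] assms(3) fT
      by (simp add: frame_act_def)
    also have "\<dots> = (\<Sum>i\<in>UNIV. Q$i$a * (\<Sum>j\<in>UNIV. Q$j$b * (\<Sum>k\<in>UNIV. Q$k$c * \<omega> [e i, e j, e k])))"
      using exp[of "[e i, e j, e c]" 2 UNIV e "\<lambda>k. Q$k$c" for i j] assms(3)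
      by (simp add: frame_act_def numeral_2_eq_2)
    finally show ?thesis .
  qed
  then show ?thesis by (simp add: frame_components_def transform_array_def vec_eq_iff)
qed

lemma components_alternating:
  assumes "\<omega> \<in> alt_forms T 3" "subspace T"
  shows "frame_components e \<omega> \<in> alternating_arrays"
proof -
  have "frame_components e \<omega> $i$j$k + frame_components e \<omega> $j$i$k = 0 \<and>
      frame_components e \<omega> $i$j$k + frame_components e \<omega> $i$k$j = 0" for i j k
    using alt_forms_swap3[OF assms, of "e i" "e j" "e k"] by (simp add: frame_components_def)
  then show ?thesis unfolding alternating_arrays_def by blast
qed

text \<open>A basis \<open>e\<close> of \<open>T\<close> with its coordinate functionals
  \<open>co\<close>. Their linearity is asked on \<open>T\<close> alone because a Riemannian metric
  is constrained only on tangent vectors. The instances are tangent spaces with orthonormal frames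
  and \<open>real^'n\<close> with its standard basis.\<close>

locale framed_space =
  fixes T :: "'v::real_vector set" and e :: "'n::finite \<Rightarrow> 'v" and co :: "'n \<Rightarrow> 'v \<Rightarrow> real"
  assumes subspace_T: "subspace T"
    and frame_in: "e i \<in> T"
    and co_linear: "x \<in> T \<Longrightarrow> y \<in> T \<Longrightarrow> co i (a *\<^sub>R x + b *\<^sub>R y) = a * co i x + b * co i y"
    and co_frame: "co i (e j) = (if i = j then 1 else 0)"
    and frame_expansion: "x \<in> T \<Longrightarrow> x = (\<Sum>i\<in>UNIV. co i x *\<^sub>R e i)"
begin

definition form_of :: "real^'n^'n^'n \<Rightarrow> 'v form" where
  "form_of x = (\<lambda>vs. if length vs = 3 \<and> set vs \<subseteq> T then
     \<Sum>i\<in>UNIV. \<Sum>j\<in>UNIV. \<Sum>k\<in>UNIV. co i (vs ! 0) * co j (vs ! 1) * co k (vs ! 2) * x$i$j$k else 0)"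

lemma linear_form_of: "linear form_of"
  by (rule linearI)
     (auto simp: form_of_def fun_eq_iff plus_fun_def scaleR_fun_def sum.distrib sum_distrib_left algebra_simps)

text \<open>Valid for every array, alternating or not, so \<open>form_of\<close> is injective on the
  whole space of arrays.\<close>

lemma components_form_of: "frame_components e (form_of x) = x"
proof -
  have "(\<Sum>i\<in>UNIV. \<Sum>j\<in>UNIV. \<Sum>k\<in>UNIV. co i (e a) * co j (e b) * co k (e c) * x$i$j$k) = x$a$b$c" for a b c
  proof -
    have "(\<Sum>i\<in>UNIV. \<Sum>j\<in>UNIV. \<Sum>k\<in>UNIV. co i (e a) * co j (e b) * co k (e c) * x$i$j$k)
        = (\<Sum>i\<in>UNIV. co i (e a) * (\<Sum>j\<in>UNIV. co j (e b) * (\<Sum>k\<in>UNIV. co k (e c) * x$i$j$k)))"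
      by (simp add: sum_distrib_left algebra_simps)
    also have "\<dots> = x$a$b$c"
      by (simp add: co_frame if_distrib[of "\<lambda>x. x * _"] cong: if_cong)
    finally show ?thesis .
  qed
  then show ?thesis
    by (simp add: frame_components_def form_of_def vec_eq_iff frame_in numeral_2_eq_2)
qed

lemma form_of_alt_forms:
  assumes "x \<in> alternating_arrays"
  shows "form_of x \<in> alt_forms T 3"
proof (rule alt_forms_3I)
  note x = alternating_arraysD[OF assms]
  fix u v w
  have "(\<Sum>i\<in>UNIV. \<Sum>j\<in>UNIV. \<Sum>k\<in>UNIV. co i u * co j v * co k w * x$i$j$k)
      = (\<Sum>j\<in>UNIV. \<Sum>i\<in>UNIV. \<Sum>k\<in>UNIV. co i u * co j v * co k w * x$i$j$k)" by (rule sum.swap)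
  also have "\<dots> = (\<Sum>j\<in>UNIV. \<Sum>i\<in>UNIV. \<Sum>k\<in>UNIV. - (co j v * co i u * co k w * x$j$i$k))"
    by (intro sum.cong refl, subst x(1)) simp
  finally show "form_of x [u, v, w] = - form_of x [v, u, w]"
    by (auto simp: form_of_def numeral_2_eq_2 sum_negf)
  have "(\<Sum>i\<in>UNIV. \<Sum>j\<in>UNIV. \<Sum>k\<in>UNIV. co i u * co j v * co k w * x$i$j$k)
      = (\<Sum>i\<in>UNIV. \<Sum>k\<in>UNIV. \<Sum>j\<in>UNIV. co i u * co j v * co k w * x$i$j$k)"
    by (intro sum.cong refl sum.swap)
  also have "\<dots> = (\<Sum>i\<in>UNIV. \<Sum>k\<in>UNIV. \<Sum>j\<in>UNIV. - (co i u * co k w * co j v * x$i$k$j))"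
    by (intro sum.cong refl, subst x(2)) simp
  finally show "form_of x [u, v, w] = - form_of x [u, w, v]"
    by (auto simp: form_of_def numeral_2_eq_2 sum_negf)
next
  fix u u' v w a b assume "u \<in> T" "u' \<in> T" "v \<in> T" "w \<in> T"
  moreover from this have "a *\<^sub>R u + b *\<^sub>R u' \<in> T"
    by (intro subspace_add[OF subspace_T] subspace_scale[OF subspace_T])
  ultimately show "form_of x [a *\<^sub>R u + b *\<^sub>R u', v, w] = a * form_of x [u, v, w] + b * form_of x [u', v, w]"
    by (simp add: form_of_def co_linear sum.distrib sum_distrib_left algebra_simps)
qed (auto simp: form_of_def)

lemma form_of_components:
  assumes "\<omega> \<in> alt_forms T 3"
  shows "form_of (frame_components e \<omega>) = \<omega>"
proof
  fix vs
  show "form_of (frame_components e \<omega>) vs = \<omega> vs"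
  proof (cases "length vs = 3 \<and> set vs \<subseteq> T")
    case True
    then obtain u v w where vs: "vs = [u, v, w]" using length_3_cases by blast
    then have T: "u \<in> T" "v \<in> T" "w \<in> T" using True by auto
    note exp = alt_forms_sum[OF assms subspace_T]
    have "\<omega> [u, v, w] = (\<Sum>i\<in>UNIV. co i u * \<omega> [e i, v, w])"
      using exp[of "[u, v, w]" 0 UNIV e "\<lambda>i. co i u"] T frame_in frame_expansion[of u] by simp
    also have "\<dots> = (\<Sum>i\<in>UNIV. co i u * (\<Sum>j\<in>UNIV. co j v * \<omega> [e i, e j, w]))"
      using exp[of "[e i, v, w]" 1 UNIV e "\<lambda>i. co i v" for i] T frame_in frame_expansion[of v] by simp
    also have "\<dots> = (\<Sum>i\<in>UNIV. co i u * (\<Sum>j\<in>UNIV. co j v * (\<Sum>k\<in>UNIV. co k w * \<omega> [e i, e j, e k])))"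
      using exp[of "[e i, e j, w]" 2 UNIV e "\<lambda>i. co i w" for i j] T frame_in frame_expansion[of w]
      by (simp add: numeral_2_eq_2)
    finally show ?thesis
      using T by (simp add: vs form_of_def frame_components_def numeral_2_eq_2 sum_distrib_left algebra_simps)
  next
    case False
    then show ?thesis using alt_forms_support[OF assms] by (auto simp: form_of_def)
  qed
qed

lemma form_of_image: "form_of ` alternating_arrays = alt_forms T 3"
proof
  show "form_of ` alternating_arrays \<subseteq> alt_forms T 3" using form_of_alt_forms by blast
  show "alt_forms T 3 \<subseteq> form_of ` alternating_arrays"
    using form_of_components components_alternating[OF _ subspace_T] by (metis imageI subsetI)
qed

end

section \<open>The flux operator in a frame\<close>

lemma sum_fun_apply: "(\<Sum>i\<in>I. f i) x = (\<Sum>i\<in>I. f i x)"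
  for f :: "'i \<Rightarrow> 'a \<Rightarrow> 'b::comm_monoid_add"
  by (induction I rule: infinite_finite_induct) simp_all

text \<open>Antisymmetry of \<open>\<beta>\<close> makes the six permutations agree in pairs, which
  absorbs the factor \<open>fact 2\<close> of the normalisation and leaves the three cyclic
  terms.\<close>

lemma wedge_1_2:
  assumes "\<And>u v. \<beta> [u, v] = - \<beta> [v, u]"
  shows "wedge 1 2 \<alpha> \<beta> [x, y, z] = \<alpha> [x] * \<beta> [y, z] + \<alpha> [y] * \<beta> [z, x] + \<alpha> [z] * \<beta> [x, y]"
proof -
  \<comment> \<open>The index set is built up by insertions so that the sum over its permutations
    unfolds into compositions with transpositions.\<close>
  have set: "{..<1 + 2 :: nat} = insert 0 (insert 1 {2})" by auto
  have f: "finite (insert 1 {2::nat})" "(0::nat) \<notin> insert 1 {2}" "finite {2::nat}" "(1::nat) \<notin> {2}"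
    by auto
  have l: "[0..<1] = [0::nat]" "[1..<1 + 2] = [1, 2::nat]" by (simp_all add: upt_rec)
  show ?thesis
    unfolding wedge_def l set sum_over_permutations_insert[OF f(1,2)]
      sum_over_permutations_insert[OF f(3,4)] permutes_sing
    using assms[of z y] assms[of x z] assms[of y x]
    by (simp add: sign_swap_id permutation_swap_id sign_compose sign_id transpose_def
        fact_numeral numeral_2_eq_2 field_simps)
qed

text \<open>The flux operator with the frame as a parameter: \<open>H_op\<close> is fixed to
  \<open>onb M p\<close>, but it has to be evaluated in frames of the G-structure.\<close>

definition frame_flux :: "('n::finite \<Rightarrow> 'v) \<Rightarrow> 'v form \<Rightarrow> 'v form \<Rightarrow> 'v form" where
  "frame_flux e \<psi> \<xi> = (1/2) *\<^sub>R (\<Sum>i\<in>UNIV. \<Sum>j\<in>UNIV.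
     wedge 1 2 (contract (e j) (contract (e i) \<xi>)) (contract (e j) (contract (e i) \<psi>)))"

text \<open>The flux operator on components, \<open>s i j k l\<close> being the coefficients of
  \<psi>; the three terms are the cyclic ones of \<open>wedge_1_2\<close>.\<close>

definition array_flux :: "('n \<Rightarrow> 'n \<Rightarrow> 'n \<Rightarrow> 'n \<Rightarrow> real) \<Rightarrow> real^'n^'n^'n \<Rightarrow> real^'n^'n^'n" where
  "array_flux s x = (\<chi> a b c. (\<Sum>i\<in>UNIV. \<Sum>j\<in>UNIV.
     x$i$j$a * s i j b c + x$i$j$b * s i j c a + x$i$j$c * s i j a b) / 2)"

lemma H_op_frame_flux: "flux_op M p = frame_flux (onb M p) (psi M p)"
  by (simp add: H_op_def frame_flux_def fun_eq_iff)

lemma linear_frame_flux: "linear (frame_flux e \<psi>)"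
proof (rule linearI)
  have add: "wedge p q (\<alpha> + \<alpha>') \<beta> = wedge p q \<alpha> \<beta> + wedge p q \<alpha>' \<beta>" for p q and \<alpha> \<alpha>' \<beta> :: "'a form"
    by (auto simp: wedge_def fun_eq_iff plus_fun_def sum.distrib algebra_simps add_divide_distrib)
  have scale: "wedge p q (r *\<^sub>R \<alpha>) \<beta> = r *\<^sub>R wedge p q \<alpha> \<beta>" for p q r and \<alpha> \<beta> :: "'a form"
    by (auto simp: wedge_def fun_eq_iff scaleR_fun_def sum_distrib_left algebra_simps)
  have c: "contract v (\<alpha> + \<alpha>') = contract v \<alpha> + contract v \<alpha>'"
    "contract v (r *\<^sub>R \<alpha>) = r *\<^sub>R contract v \<alpha>" for v r and \<alpha> \<alpha>' :: "'a form"
    by (simp_all add: contract_def plus_fun_def scaleR_fun_def)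
  show "frame_flux e \<psi> (\<xi> + \<xi>') = frame_flux e \<psi> \<xi> + frame_flux e \<psi> \<xi>'" for \<xi> \<xi>'
    unfolding frame_flux_def c add sum.distrib scaleR_add_right ..
  show "frame_flux e \<psi> (r *\<^sub>R \<xi>) = r *\<^sub>R frame_flux e \<psi> \<xi>" for r \<xi>
    unfolding frame_flux_def c scale by (simp only: scaleR_sum_right scaleR_scaleR mult.commute)
qed

lemma frame_flux_apply:
  assumes "\<psi> \<in> alt_forms T 4" "subspace T"
  shows "frame_flux e \<psi> \<xi> [x, y, z] = (\<Sum>i\<in>UNIV. \<Sum>j\<in>UNIV. \<xi> [e i, e j, x] * \<psi> [e i, e j, y, z] +
      \<xi> [e i, e j, y] * \<psi> [e i, e j, z, x] + \<xi> [e i, e j, z] * \<psi> [e i, e j, x, y]) / 2"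
proof -
  have w: "wedge 1 2 (contract (e j) (contract (e i) \<xi>)) (contract (e j) (contract (e i) \<psi>)) [x, y, z] =
      \<xi> [e i, e j, x] * \<psi> [e i, e j, y, z] + \<xi> [e i, e j, y] * \<psi> [e i, e j, z, x] +
      \<xi> [e i, e j, z] * \<psi> [e i, e j, x, y]" for i j
  proof -
    have "contract (e j) (contract (e i) \<psi>) [u, v] = - contract (e j) (contract (e i) \<psi>) [v, u]" for u v
      unfolding contract_def by (rule alt_forms_swap4(3)[OF assms])
    from wedge_1_2[of "contract (e j) (contract (e i) \<psi>)", OF this] show ?thesis
      unfolding contract_def .
  qed
  show ?thesis unfolding frame_flux_def scaleR_fun_def sum_fun_apply w by simp
qed

lemma frame_flux_alt_forms:
  assumes \<psi>: "\<psi> \<in> alt_forms T 4" and \<xi>: "\<xi> \<in> alt_forms T 3" and T: "subspace T" and e: "\<And>i. e i \<in> T"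
  shows "frame_flux e \<psi> \<xi> \<in> alt_forms T 3"
proof (rule alt_forms_3I)
  note ap = frame_flux_apply[OF \<psi> T]
  have sw: "\<psi> [a, b, u, v] = - \<psi> [a, b, v, u]" for a b u v by (rule alt_forms_swap4(3)[OF \<psi> T])
  show "frame_flux e \<psi> \<xi> vs = 0" if nin: "\<not> (length vs = 3 \<and> set vs \<subseteq> T)" for vs
  proof (cases "length vs = 3")
    case True
    then obtain x y z where vs: "vs = [x, y, z]" using length_3_cases by blast
    then consider "x \<notin> T" | "y \<notin> T" | "z \<notin> T" using nin by auto
    then show ?thesis
      by cases (simp_all add: vs ap alt_forms_support[OF \<psi>] alt_forms_support[OF \<xi>])
  next
    case False
    then show ?thesis by (simp add: frame_flux_def scaleR_fun_def sum_fun_apply wedge_def)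
  qed
  \<comment> \<open>Exchanging two arguments permutes the three cyclic terms and reverses the last
    two arguments of \<psi> in each of them.\<close>
  show "frame_flux e \<psi> \<xi> [x, y, z] = - frame_flux e \<psi> \<xi> [y, x, z]" for x y z
    unfolding ap sw[of _ _ x z] sw[of _ _ z y] sw[of _ _ y x] by (simp add: sum_negf[symmetric] algebra_simps)
  show "frame_flux e \<psi> \<xi> [x, y, z] = - frame_flux e \<psi> \<xi> [x, z, y]" for x y z
    unfolding ap sw[of _ _ z y] sw[of _ _ y x] sw[of _ _ x z] by (simp add: sum_negf[symmetric] algebra_simps)
  fix x x' y z a b assume in_T: "x \<in> T" "x' \<in> T" "y \<in> T" "z \<in> T"
  have 1: "\<xi> [u, v, a *\<^sub>R x + b *\<^sub>R x'] = a * \<xi> [u, v, x] + b * \<xi> [u, v, x']" if "u \<in> T" "v \<in> T" for u v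
    using alt_forms_linear[OF \<xi>, of "[u, v, x]" 2 x x' a b] in_T that by (simp add: numeral_2_eq_2)
  have 2: "\<psi> [u, v, a *\<^sub>R x + b *\<^sub>R x', w] = a * \<psi> [u, v, x, w] + b * \<psi> [u, v, x', w]"
    if "u \<in> T" "v \<in> T" "w \<in> T" for u v w
    using alt_forms_linear[OF \<psi>, of "[u, v, x, w]" 2 x x' a b] in_T that by (simp add: numeral_2_eq_2)
  have 3: "\<psi> [u, v, w, a *\<^sub>R x + b *\<^sub>R x'] = a * \<psi> [u, v, w, x] + b * \<psi> [u, v, w, x']"
    if "u \<in> T" "v \<in> T" "w \<in> T" for u v w
    using alt_forms_linear[OF \<psi>, of "[u, v, w, x]" 3 x x' a b] in_T that by (simp add: numeral_3_eq_3)
  show "frame_flux e \<psi> \<xi> [a *\<^sub>R x + b *\<^sub>R x', y, z] =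
      a * frame_flux e \<psi> \<xi> [x, y, z] + b * frame_flux e \<psi> \<xi> [x', y, z]"
    by (simp add: ap 1 2 3 e in_T sum_distrib_left sum.distrib algebra_simps add_divide_distrib)
qed

text \<open>A double contraction over an orthonormal frame does not see the frame; the two frame
  indices are replaced one after the other.\<close>

lemma sum_orthogonal_frame2:
  fixes Q :: "real^'n^'n"
  assumes Q: "orthogonal_matrix Q"
    and \<psi>: "\<psi> \<in> alt_forms T 4" and \<xi>: "\<xi> \<in> alt_forms T 3" and T: "subspace T"
    and e: "\<And>i. e i \<in> T" and xyz: "x \<in> T" "y \<in> T" "z \<in> T"
  shows "(\<Sum>i\<in>UNIV. \<Sum>j\<in>UNIV. \<xi> [frame_act e Q i, frame_act e Q j, x] * \<psi> [frame_act e Q i, frame_act e Q j, y, z])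
    = (\<Sum>i\<in>UNIV. \<Sum>j\<in>UNIV. \<xi> [e i, e j, x] * \<psi> [e i, e j, y, z])"
proof -
  let ?f = "frame_act e Q"
  have f: "?f i \<in> T" for i
    unfolding frame_act_def using e by (intro subspace_sum[OF T] subspace_scale[OF T]) auto
  \<comment> \<open>In the lists given to \<open>alt_forms_sum\<close> the entry at the updated
    position is a placeholder: \<open>v\<close> in the first slot here, \<open>v\<close> in the
    second slot for the facts 3 and 4.\<close>
  have 1: "\<xi> [?f i, v, x] = (\<Sum>k\<in>UNIV. Q$k$i * \<xi> [e k, v, x])" if "v \<in> T" for i v
    using alt_forms_sum[OF \<xi> T, of "[v, v, x]" 0 UNIV e "\<lambda>k. Q$k$i"] that xyz e by (simp add: frame_act_def)
  have 2: "\<psi> [?f i, v, y, z] = (\<Sum>k\<in>UNIV. Q$k$i * \<psi> [e k, v, y, z])" if "v \<in> T" for i v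
    using alt_forms_sum[OF \<psi> T, of "[v, v, y, z]" 0 UNIV e "\<lambda>k. Q$k$i"] that xyz e by (simp add: frame_act_def)
  have 3: "\<xi> [v, ?f j, x] = (\<Sum>k\<in>UNIV. Q$k$j * \<xi> [v, e k, x])" if "v \<in> T" for j v
    using alt_forms_sum[OF \<xi> T, of "[v, v, x]" 1 UNIV e "\<lambda>k. Q$k$j"] that xyz e by (simp add: frame_act_def)
  have 4: "\<psi> [v, ?f j, y, z] = (\<Sum>k\<in>UNIV. Q$k$j * \<psi> [v, e k, y, z])" if "v \<in> T" for j v
    using alt_forms_sum[OF \<psi> T, of "[v, v, y, z]" 1 UNIV e "\<lambda>k. Q$k$j"] that xyz e by (simp add: frame_act_def)
  have "(\<Sum>i\<in>UNIV. \<Sum>j\<in>UNIV. \<xi> [?f i, ?f j, x] * \<psi> [?f i, ?f j, y, z])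
      = (\<Sum>i\<in>UNIV. \<Sum>j\<in>UNIV. \<xi> [?f i, e j, x] * \<psi> [?f i, e j, y, z])"
    by (simp only: 3[OF f] 4[OF f] orthogonal_matrix_sum[OF Q])
  also have "\<dots> = (\<Sum>j\<in>UNIV. \<Sum>i\<in>UNIV. \<xi> [?f i, e j, x] * \<psi> [?f i, e j, y, z])"
    by (rule sum.swap)
  also have "\<dots> = (\<Sum>j\<in>UNIV. \<Sum>i\<in>UNIV. \<xi> [e i, e j, x] * \<psi> [e i, e j, y, z])"
    by (simp only: 1[OF e] 2[OF e] orthogonal_matrix_sum[OF Q])
  also have "\<dots> = (\<Sum>i\<in>UNIV. \<Sum>j\<in>UNIV. \<xi> [e i, e j, x] * \<psi> [e i, e j, y, z])"
    by (rule sum.swap)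
  finally show ?thesis .
qed

lemma frame_flux_frame_act:
  assumes Q: "orthogonal_matrix Q" and \<psi>: "\<psi> \<in> alt_forms T 4" and \<xi>: "\<xi> \<in> alt_forms T 3"
    and T: "subspace T" and e: "\<And>i. e i \<in> T"
  shows "frame_flux (frame_act e Q) \<psi> \<xi> = frame_flux e \<psi> \<xi>"
proof
  fix vs
  have f: "frame_act e Q i \<in> T" for i
    unfolding frame_act_def using e by (intro subspace_sum[OF T] subspace_scale[OF T]) auto
  show "frame_flux (frame_act e Q) \<psi> \<xi> vs = frame_flux e \<psi> \<xi> vs"
  proof (cases "length vs = 3 \<and> set vs \<subseteq> T")
    case True
    then obtain x y z where vs: "vs = [x, y, z]" using length_3_cases by blast
    then have xyz: "x \<in> T" "y \<in> T" "z \<in> T" using True by auto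
    note fr = sum_orthogonal_frame2[OF Q \<psi> \<xi> T e]
    show ?thesis
      unfolding vs frame_flux_apply[OF \<psi> T] sum.distrib
        fr[OF xyz] fr[OF xyz(2,3,1)] fr[OF xyz(3,1,2)] ..
  next
    case False
    show ?thesis
      unfolding alt_forms_support[OF frame_flux_alt_forms[OF \<psi> \<xi> T e] False]
        alt_forms_support[OF frame_flux_alt_forms[OF \<psi> \<xi> T f] False] ..
  qed
qed

lemma components_frame_flux:
  assumes "\<psi> \<in> alt_forms T 4" "subspace T"
  shows "frame_components e (frame_flux e \<psi> \<xi>) =
    array_flux (\<lambda>i j k l. \<psi> [e i, e j, e k, e l]) (frame_components e \<xi>)"
  by (simp add: frame_components_def array_flux_def frame_flux_apply[OF assms])

lemma linear_array_flux: "linear (array_flux s)"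
  by (rule linearI)
     (simp_all add: array_flux_def vec_eq_iff sum.distrib sum_distrib_left algebra_simps add_divide_distrib)

text \<open>Cyclic symmetry of the second array makes the three terms of the pairing equal, hence
  the factor 3/2. What remains is symmetric in the two arrays under exchange of the index pairs
  \<open>(i,j)\<close> and \<open>(b,c)\<close>, by the pair symmetry of \<open>s\<close>.\<close>

lemma array_flux_self_adjoint:
  assumes x: "x \<in> alternating_arrays" and y: "y \<in> alternating_arrays"
    and s: "\<And>i j k l. s i j k l = s k l i j"
  shows "array_flux s x \<bullet> y = x \<bullet> array_flux s y"
proof -
  have cyc: "v$i$j$k = v$j$k$i" if "v \<in> alternating_arrays" for v :: "real^'a^'a^'a" and i j k
    using alternating_arraysD(1)[OF that, of i j k] alternating_arraysD(2)[OF that, of j i k] by simp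
  \<comment> \<open>A single sum over quintuples turns each symmetry used below into a bijective
    reindexing.\<close>
  define X where "X u v = (\<Sum>(a,b,c,i,j)\<in>UNIV. u$i$j$a * s i j b c * v$a$b$c)" for u v :: "real^'a^'a^'a"
  have flux_X: "array_flux s u \<bullet> v = 3 / 2 * X u v" if v: "v \<in> alternating_arrays" for u v
  proof -
    have "array_flux s u \<bullet> v = (\<Sum>(a,b,c,i,j)\<in>UNIV.
        (u$i$j$a * s i j b c + u$i$j$b * s i j c a + u$i$j$c * s i j a b) * v$a$b$c) / 2"
      by (simp add: inner_array array_flux_def sum_distrib_right sum_divide_distrib
          UNIV_Times_UNIV[symmetric] sum.cartesian_product[symmetric] del: UNIV_Times_UNIV)
    also have "\<dots> = (X u v + (\<Sum>(a,b,c,i,j)\<in>UNIV. u$i$j$b * s i j c a * v$a$b$c)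
        + (\<Sum>(a,b,c,i,j)\<in>UNIV. u$i$j$c * s i j a b * v$a$b$c)) / 2"
      by (simp add: X_def sum.distrib[symmetric] case_prod_beta algebra_simps)
    also have "(\<Sum>(a,b,c,i,j)\<in>UNIV. u$i$j$b * s i j c a * v$a$b$c) = X u v"
      unfolding X_def
      by (rule sum.reindex_bij_witness[of _ "\<lambda>(a,b,c,i,j). (c,a,b,i,j)" "\<lambda>(a,b,c,i,j). (b,c,a,i,j)"])
         (auto simp: cyc[OF v, symmetric])
    also have "(\<Sum>(a,b,c,i,j)\<in>UNIV. u$i$j$c * s i j a b * v$a$b$c) = X u v"
      unfolding X_def
      by (rule sum.reindex_bij_witness[of _ "\<lambda>(a,b,c,i,j). (b,c,a,i,j)" "\<lambda>(a,b,c,i,j). (c,a,b,i,j)"])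
         (auto simp: cyc[OF v])
    finally show ?thesis by simp
  qed
  have "X x y = X y x"
    unfolding X_def
  proof (rule sum.reindex_bij_witness[of _ "\<lambda>(a,b,c,i,j). (a,i,j,b,c)" "\<lambda>(a,b,c,i,j). (a,i,j,b,c)"]; clarsimp)
    fix a b c i j
    show "y$b$c$a * s b c i j * x$a$i$j = x$i$j$a * s i j b c * y$a$b$c"
      using cyc[OF y, of a b c] cyc[OF x, of a i j] s[of b c i j] by simp
  qed
  then show ?thesis using flux_X[OF y, of x] flux_X[OF x, of y] by (metis inner_commute)
qed

section \<open>Transfer from arrays to the fibres\<close>

text \<open>\<open>\<Psi> p\<close> builds forms at \<open>p\<close> from arrays and
  \<open>\<Phi> p\<close> reads the components back; \<open>D\<close> does the former for the model
  forms on \<open>real^'n\<close> and is independent of \<open>p\<close>. The condition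
  \<open>inner_\<Phi>\<close> ranges over all functions on lists, because \<open>orth_proj\<close>
  is applied to the codifferential; the 6 is the \<open>fact 3\<close> in
  \<open>form_inner\<close>.\<close>

locale fibre_model = self_adjoint_intertwiner A \<G> H
  for A :: "'e::euclidean_space set" and \<G> H +
  fixes M :: "('m::topological_space, 'n::{finite,linorder}) geometry"
    and \<Psi> :: "'m \<Rightarrow> 'e \<Rightarrow> ('m, 'n) tvec form"
    and \<Phi> :: "'m \<Rightarrow> ('m, 'n) tvec form \<Rightarrow> 'e"
    and D :: "'e \<Rightarrow> (real, 'n) vec form"
  assumes linear_\<Psi>: "linear (\<Psi> p)" and linear_\<Phi>: "linear (\<Phi> p)"
    and \<Phi>_\<Psi>: "x \<in> A \<Longrightarrow> \<Phi> p (\<Psi> p x) = x"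
    and \<Psi>_A: "\<Psi> p ` A = forms_at M 3 p"
    and inner_\<Phi>: "form_inner M 3 p \<alpha> \<beta> = (\<Phi> p \<alpha> \<bullet> \<Phi> p \<beta>) / 6"
    and linear_flux: "linear (flux_op M p)"
    and flux_\<Psi>: "x \<in> A \<Longrightarrow> flux_op M p (\<Psi> p x) = \<Psi> p (H x)"
    and assoc_\<Psi>: "invariant U \<Longrightarrow> assoc_bundle M 3 (D ` U) p = \<Psi> p ` U"
    and irreducible_D: "irreducible_subrep (grp M) 3 W \<longleftrightarrow> (\<exists>U. irreducible_rep U \<and> W = D ` U)"
    and dim_D: "subspace U \<Longrightarrow> U \<subseteq> A \<Longrightarrow> dim (D ` U) = dim U"
    and isomorphic_D: "\<lbrakk>invariant U; invariant U'; linear h; bij_betw h U U';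
        \<And>g x. g \<in> \<G> \<Longrightarrow> x \<in> U \<Longrightarrow> h (g x) = g (h x)\<rbrakk> \<Longrightarrow> isomorphic_reps (grp M) (D ` U) (D ` U')"
begin

lemma inj_\<Psi>: "inj_on (\<Psi> p) A"
  by (metis \<Phi>_\<Psi> inj_onI)

lemma \<Psi>_subset_iff: "X \<subseteq> A \<Longrightarrow> Y \<subseteq> A \<Longrightarrow> \<Psi> p ` X \<subseteq> \<Psi> p ` Y \<longleftrightarrow> X \<subseteq> Y"
  using inj_\<Psi> by (metis inj_on_image_subset_iff)

lemma flux_ker_eq: "flux_ker M p = \<Psi> p ` kernel"
proof -
  have "flux_op M p (\<Psi> p x) = 0 \<longleftrightarrow> H x = 0" if "x \<in> A" for x
  proof
    assume "flux_op M p (\<Psi> p x) = 0"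
    then have "\<Psi> p (H x) = \<Psi> p 0" using flux_\<Psi>[OF that] linear_0[OF linear_\<Psi>] by simp
    then show "H x = 0"
      using inj_onD[OF inj_\<Psi>] H_A that subspace_0[OF subspace_A] by (metis image_subset_iff)
  qed (simp add: flux_\<Psi>[OF that] linear_0[OF linear_\<Psi>])
  then show ?thesis unfolding flux_ker_def kernel_def \<Psi>_A[symmetric] by blast
qed

lemma flux_ker_perp_eq: "flux_ker_perp M p = \<Psi> p ` kernel_perp"
proof -
  have "form_inner M 3 p (\<Psi> p x) (\<Psi> p y) = 0 \<longleftrightarrow> x \<bullet> y = 0" if "x \<in> A" "y \<in> A" for x y
    using that by (simp add: inner_\<Phi> \<Phi>_\<Psi>)
  moreover have "kernel \<subseteq> A" by (rule kernel_A)
  ultimately show ?thesis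
    unfolding flux_ker_perp_def kernel_perp_def flux_ker_eq \<Psi>_A[symmetric] by fast
qed

text \<open>Resolves the definite description for every \<open>\<xi>\<close>, whether or not it is a
  form. Two candidates differ by the image of an element of \<open>U\<close> that is orthogonal to
  itself.\<close>

lemma orth_proj_eq:
  assumes "subspace U" "U \<subseteq> A"
  shows "orth_proj M 3 p (\<Psi> p ` U) \<xi> = \<Psi> p (projection U (\<Phi> p \<xi>))"
  unfolding orth_proj_def
proof (rule the_equality)
  have inner: "form_inner M 3 p (\<xi> - \<Psi> p u) (\<Psi> p w) = ((\<Phi> p \<xi> - u) \<bullet> w) / 6"
    if "u \<in> U" "w \<in> U" for u w
    using that assms(2) by (simp add: inner_\<Phi> \<Phi>_\<Psi> linear_diff[OF linear_\<Phi>] subset_iff)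
  let ?u = "projection U (\<Phi> p \<xi>)"
  have u: "?u \<in> U" by (rule projection_in[OF assms(1)])
  have "form_inner M 3 p (\<xi> - \<Psi> p ?u) \<omega> = 0" if "\<omega> \<in> \<Psi> p ` U" for \<omega>
    using that inner[OF u] projection_orthogonal[OF assms(1)] by auto
  then show "\<Psi> p ?u \<in> \<Psi> p ` U \<and> (\<forall>\<omega>\<in>\<Psi> p ` U. form_inner M 3 p (\<xi> - \<Psi> p ?u) \<omega> = 0)"
    using u by blast
  fix \<eta> assume \<eta>: "\<eta> \<in> \<Psi> p ` U \<and> (\<forall>\<omega>\<in>\<Psi> p ` U. form_inner M 3 p (\<xi> - \<eta>) \<omega> = 0)"
  then obtain v where v: "v \<in> U" "\<eta> = \<Psi> p v" by blast
  have d: "v - ?u \<in> U" using u v(1) by (intro subspace_diff[OF assms(1)])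
  have "\<Psi> p (v - ?u) \<in> \<Psi> p ` U" using d by (rule imageI)
  with \<eta> v(2) have "form_inner M 3 p (\<xi> - \<Psi> p v) (\<Psi> p (v - ?u)) = 0" by metis
  then have "(\<Phi> p \<xi> - v) \<bullet> (v - ?u) = 0" using inner[OF v(1) d] by simp
  moreover have "(\<Phi> p \<xi> - ?u) \<bullet> (v - ?u) = 0" by (rule projection_orthogonal[OF assms(1) d])
  ultimately have "(v - ?u) \<bullet> (v - ?u) = 0" by (simp add: inner_diff_left)
  then show "\<eta> = \<Psi> p ?u" using v(2) by simp
qed

lemma invariant_A_subset: "invariant U \<Longrightarrow> U \<subseteq> A" and invariant_subspace: "invariant U \<Longrightarrow> subspace U"
  by (auto simp: invariant_def)

lemma irreducible_invariant: "irreducible_rep U \<Longrightarrow> invariant U"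
  by (simp add: irreducible_rep_def)

lemma perp_subbundles_eq: "perp_subbundles M d = (\<lambda>U p. \<Psi> p ` U) ` kernel_perp_irreps d"
proof (intro set_eqI iffI)
  fix E assume "E \<in> perp_subbundles M d"
  then obtain W where W: "irreducible_subrep (grp M) 3 W" "dim W = d" "E = assoc_bundle M 3 W"
      and Ep: "\<And>p. E p \<subseteq> flux_ker_perp M p"
    unfolding perp_subbundles_def irreducible_subbundle_def by blast
  from W(1) obtain U where U: "irreducible_rep U" "W = D ` U" using irreducible_D by blast
  note inv = irreducible_invariant[OF U(1)]
  have E: "E = (\<lambda>p. \<Psi> p ` U)" using W(3) U(2) assoc_\<Psi>[OF inv] by auto
  \<comment> \<open>Containment at one point is enough, since \<open>U\<close> and
    \<open>kernel_perp\<close> do not depend on the point; \<open>undefined\<close> serves as that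
    point.\<close>
  have "U \<subseteq> kernel_perp"
    using Ep[of undefined] \<Psi>_subset_iff[OF invariant_A_subset[OF inv] kernel_perp_A] by (simp add: E flux_ker_perp_eq)
  moreover have "dim U = d"
    using dim_D[OF invariant_subspace[OF inv] invariant_A_subset[OF inv]] W(2) U(2) by simp
  ultimately show "E \<in> (\<lambda>U p. \<Psi> p ` U) ` kernel_perp_irreps d" using E U(1) by (auto simp: kernel_perp_irreps_def)
next
  fix E assume "E \<in> (\<lambda>U p. \<Psi> p ` U) ` kernel_perp_irreps d"
  then obtain U where U: "irreducible_rep U" "dim U = d" "U \<subseteq> kernel_perp" "E = (\<lambda>p. \<Psi> p ` U)"
    by (auto simp: kernel_perp_irreps_def)
  note inv = irreducible_invariant[OF U(1)]
  have "irreducible_subrep (grp M) 3 (D ` U)" using irreducible_D U(1) by blast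
  moreover have "dim (D ` U) = d"
    using dim_D[OF invariant_subspace[OF inv] invariant_A_subset[OF inv]] U(2) by simp
  moreover have "E = assoc_bundle M 3 (D ` U)" using U(4) assoc_\<Psi>[OF inv] by auto
  moreover have "E p \<subseteq> flux_ker_perp M p" for p using U(3,4) by (auto simp: flux_ker_perp_eq)
  ultimately show "E \<in> perp_subbundles M d"
    unfolding perp_subbundles_def irreducible_subbundle_def by blast
qed

lemma perp_ranks_eq: "perp_ranks M = ranks"
  by (simp add: perp_ranks_def ranks_def perp_subbundles_eq)

lemma V_bundle_eq: "V_bundle M d p = \<Psi> p ` V d"
proof -
  have "(\<Union>E\<in>perp_subbundles M d. E p) = \<Psi> p ` \<Union>(kernel_perp_irreps d)"
    by (auto simp: perp_subbundles_eq)
  then show ?thesis by (simp add: V_bundle_def V_def linear_span_image[OF linear_\<Psi>])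
qed

lemma V_A: "V d \<subseteq> A"
  using V_kernel_perp kernel_perp_A by (rule order.trans)

text \<open>Independence of the summands comes from orthogonality, which is available on arrays; the
  decomposition of \<open>A\<close> is then carried over by the injective
  \<open>\<Psi> p\<close>.\<close>

lemma direct_sum_forms:
  "is_direct_sum (insert None (Some ` perp_ranks M))
     (case_option (flux_ker M p) (\<lambda>d. V_bundle M d p)) (forms_at M 3 p)"
proof -
  let ?I = "insert None (Some ` ranks)" and ?U = "case_option kernel V"
  have "is_direct_sum ?I ?U A"
  proof (rule orthogonal_is_direct_sum)
    show "finite ?I" using finite_ranks by simp
    show "subspace (?U i)" if "i \<in> ?I" for i
      using subspace_kernel subspace_V by (cases i) auto
    have kV: "x \<bullet> y = 0" "y \<bullet> x = 0" if "x \<in> kernel" "y \<in> V d" for x y d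
      using that(1) subsetD[OF V_kernel_perp that(2)] by (auto simp: kernel_perp_def inner_commute)
    show "x \<bullet> y = 0" if "i \<in> ?I" "j \<in> ?I" "i \<noteq> j" "x \<in> ?U i" "y \<in> ?U j" for i j x y
      using that kV orthogonal_V by (cases i; cases j) auto
    have UU: "(\<Union>i\<in>?I. ?U i) = kernel \<union> (\<Union>d\<in>ranks. V d)" by auto
    show "span (\<Union>i\<in>?I. ?U i) = A"
    proof
      show "span (\<Union>i\<in>?I. ?U i) \<subseteq> A"
        unfolding UU using kernel_A V_A by (intro span_minimal subspace_A) auto
      show "A \<subseteq> span (\<Union>i\<in>?I. ?U i)"
      proof
        fix x assume x: "x \<in> A"
        let ?k = "projection kernel x"
        have k: "?k \<in> kernel" by (rule projection_in[OF subspace_kernel])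
        have "x - ?k \<in> A" using x k kernel_A by (intro subspace_diff[OF subspace_A]) auto
        then have "x - ?k \<in> kernel_perp"
          using projection_orthogonal[OF subspace_kernel] by (simp add: kernel_perp_def)
        then have "x - ?k \<in> span (kernel \<union> (\<Union>d\<in>ranks. V d))"
          using span_mono[of "\<Union>d\<in>ranks. V d" "kernel \<union> (\<Union>d\<in>ranks. V d)"] span_V by blast
        moreover have "?k \<in> span (kernel \<union> (\<Union>d\<in>ranks. V d))" using k by (intro span_base) simp
        ultimately have "(x - ?k) + ?k \<in> span (kernel \<union> (\<Union>d\<in>ranks. V d))" by (rule span_add)
        then show "x \<in> span (\<Union>i\<in>?I. ?U i)" unfolding UU by simp
      qed
    qed
  qed
  from is_direct_sum_linear_image[OF linear_\<Psi> inj_\<Psi> subspace_A this]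
  have "is_direct_sum ?I (\<lambda>i. \<Psi> p ` ?U i) (forms_at M 3 p)" by (simp add: \<Psi>_A)
  moreover have "(\<lambda>i. \<Psi> p ` ?U i) = case_option (flux_ker M p) (\<lambda>d. V_bundle M d p)"
    by (auto simp: fun_eq_iff flux_ker_eq V_bundle_eq split: option.split)
  ultimately show ?thesis by (simp add: perp_ranks_eq)
qed

lemma flux_V_bundle:
  "flux_op M p ` V_bundle M d p \<subseteq> V_bundle M d p"
  "bij_betw (flux_op M p) (V_bundle M d p) (V_bundle M d p)"
proof -
  have eq: "flux_op M p ` V_bundle M d p = V_bundle M d p"
  proof -
    have "flux_op M p ` V_bundle M d p = (\<lambda>x. \<Psi> p (H x)) ` V d"
      using flux_\<Psi> V_A unfolding V_bundle_eq image_image by (intro image_cong) auto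
    also have "\<dots> = \<Psi> p ` H ` V d" by (simp add: image_image)
    also have "H ` V d = V d" using bij_V by (simp add: bij_betw_def)
    finally show ?thesis by (simp add: V_bundle_eq)
  qed
  then show "flux_op M p ` V_bundle M d p \<subseteq> V_bundle M d p" by simp
  have "inj_on (flux_op M p) (V_bundle M d p)"
  proof (rule inj_onI)
    fix \<alpha> \<beta> assume "\<alpha> \<in> V_bundle M d p" "\<beta> \<in> V_bundle M d p" and *: "flux_op M p \<alpha> = flux_op M p \<beta>"
    then obtain x y where xy: "x \<in> V d" "y \<in> V d" "\<alpha> = \<Psi> p x" "\<beta> = \<Psi> p y" by (auto simp: V_bundle_eq)
    then have "\<Psi> p (H x) = \<Psi> p (H y)" using * flux_\<Psi> V_A by (metis subsetD)
    then have "H x = H y" using inj_onD[OF inj_\<Psi>] xy H_A V_A by (metis image_subset_iff subsetD)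
    then show "\<alpha> = \<beta>" using bij_V xy by (metis bij_betw_def inj_onD)
  qed
  with eq show "bij_betw (flux_op M p) (V_bundle M d p) (V_bundle M d p)" by (simp add: bij_betw_def)
qed

text \<open>The description of \<open>flux_form\<close> ranges over sections, but its condition is
  pointwise, and injectivity of \<open>H\<close> on \<open>kernel_perp\<close> leaves one value at
  each point. Exhibiting a solution therefore identifies the flux form.\<close>

lemma flux_form_unique:
  assumes "\<And>p. x p \<in> kernel_perp" "\<And>p. H (x p) = projection kernel_perp (\<Phi> p (codiff M 4 (psi M) p))"
  shows "flux_form M = (\<lambda>p. \<Psi> p (x p))"
  unfolding flux_form_def
proof (rule the_equality)
  note proj = orth_proj_eq[OF subspace_kernel_perp kernel_perp_A]
  show "\<forall>p. \<Psi> p (x p) \<in> flux_ker_perp M p \<and>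
      orth_proj M 3 p (flux_ker_perp M p) (codiff M 4 (psi M) p) = flux_op M p (\<Psi> p (x p))"
    using assms kernel_perp_A by (auto simp: flux_ker_perp_eq proj flux_\<Psi> subset_iff)
  fix F assume F: "\<forall>p. F p \<in> flux_ker_perp M p \<and>
      orth_proj M 3 p (flux_ker_perp M p) (codiff M 4 (psi M) p) = flux_op M p (F p)"
  show "F = (\<lambda>p. \<Psi> p (x p))"
  proof
    fix p
    obtain y where y: "y \<in> kernel_perp" "F p = \<Psi> p y" using F by (auto simp: flux_ker_perp_eq)
    have yA: "y \<in> A" using y(1) kernel_perp_A by blast
    have "\<Psi> p (H (x p)) = \<Psi> p (H y)"
      using F[rule_format, of p] by (simp add: flux_ker_perp_eq proj assms(2) y(2) flux_\<Psi>[OF yA])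
    moreover have "H (x p) \<in> A" "H y \<in> A" using H_A kernel_perp_A assms(1) y(1) by blast+
    ultimately have "H (x p) = H y" using inj_onD[OF inj_\<Psi>] by metis
    then have "x p = y" using inj_onD[OF inj_on_kernel_perp] assms(1) y(1) by metis
    then show "F p = \<Psi> p (x p)" using y(2) by simp
  qed
qed

text \<open>The common core of both formulas: the \<open>U i\<close> are the \<open>V d\<close> in
  one case and the given irreducible summands in the other. Projecting onto
  \<open>kernel_perp\<close> is the sum of the projections onto its orthogonal pieces.\<close>

lemma flux_form_sum:
  assumes "finite I" "\<And>i. i \<in> I \<Longrightarrow> subspace (U i)"
    and orth: "\<And>i j x y. \<lbrakk>i \<in> I; j \<in> I; i \<noteq> j; x \<in> U i; y \<in> U j\<rbrakk> \<Longrightarrow> x \<bullet> y = 0"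
    and span: "span (\<Union>i\<in>I. U i) = kernel_perp"
    and u: "\<And>i p. i \<in> I \<Longrightarrow> u i p \<in> U i"
      "\<And>i p. i \<in> I \<Longrightarrow> H (u i p) = projection (U i) (\<Phi> p (codiff M 4 (psi M) p))"
  shows "flux_form M p = (\<Sum>i\<in>I. \<Psi> p (u i p))"
proof -
  let ?c = "\<lambda>p. \<Phi> p (codiff M 4 (psi M) p)"
  have Uc: "U i \<subseteq> kernel_perp" if "i \<in> I" for i
    using that span span_superset[of "\<Union>i\<in>I. U i"] by blast
  have "(\<Sum>i\<in>I. u i p) \<in> kernel_perp" for p
    using Uc u(1) by (intro subspace_sum[OF subspace_kernel_perp]) blast
  moreover have "H (\<Sum>i\<in>I. u i p) = projection kernel_perp (?c p)" for p
  proof -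
    let ?P = "\<lambda>i. projection (U i) (?c p)"
    \<comment> \<open>This difference is orthogonal to every \<open>U j\<close> and lies in their
      span, so it vanishes.\<close>
    let ?z = "(\<Sum>i\<in>I. ?P i) - projection kernel_perp (?c p)"
    have PU: "?P i \<in> U i" if "i \<in> I" for i by (rule projection_in[OF assms(2)[OF that]])
    have z: "?z \<in> kernel_perp"
      using Uc PU projection_in[OF subspace_kernel_perp]
      by (intro subspace_diff[OF subspace_kernel_perp] subspace_sum[OF subspace_kernel_perp]) auto
    have "?z \<bullet> w = 0" if j: "j \<in> I" and w: "w \<in> U j" for j w
    proof -
      have "(\<Sum>i\<in>I. ?P i) \<bullet> w = (\<Sum>i\<in>I. if i = j then ?P j \<bullet> w else 0)"
        unfolding inner_sum_left
      proof (rule sum.cong[OF refl])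
        fix i assume "i \<in> I"
        then show "?P i \<bullet> w = (if i = j then ?P j \<bullet> w else 0)"
          using orth[OF _ j _ PU w] by auto
      qed
      then have "(\<Sum>i\<in>I. ?P i) \<bullet> w = ?c p \<bullet> w"
        using assms(1) j projection_orthogonal[OF assms(2)[OF j] w, of "?c p"] by (simp add: inner_diff_left)
      moreover have "projection kernel_perp (?c p) \<bullet> w = ?c p \<bullet> w"
        using projection_orthogonal[OF subspace_kernel_perp, of w "?c p"] Uc[OF j] w by (auto simp: inner_diff_left)
      ultimately show ?thesis by (simp add: inner_diff_left)
    qed
    then have "x \<bullet> w = 0" if "x \<in> {?z}" "w \<in> (\<Union>i\<in>I. U i)" for x w using that by blast
    then have "x \<bullet> w = 0" if "x \<in> span {?z}" "w \<in> span (\<Union>i\<in>I. U i)" for x w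
      using that by (rule orthogonal_to_spans)
    from this[of ?z ?z] have "?z \<bullet> ?z = 0" using z span by (simp add: span_base)
    then show ?thesis by (simp add: linear_sum[OF linear_H] u(2))
  qed
  ultimately have "flux_form M = (\<lambda>p. \<Psi> p (\<Sum>i\<in>I. u i p))" by (rule flux_form_unique)
  then show ?thesis by (simp add: linear_sum[OF linear_\<Psi>])
qed

lemma tau_eq:
  assumes "subspace U" "U \<subseteq> A" "E p = \<Psi> p ` U"
  shows "tau M E p = \<Psi> p (projection U (\<Phi> p (codiff M 4 (psi M) p)))"
  using orth_proj_eq[OF assms(1,2)] by (simp add: tau_def assms(3))

lemma flux_form_eq:
  "flux_form M p = (\<Sum>d\<in>perp_ranks M. inv_into (V_bundle M d p) (flux_op M p) (tau M (V_bundle M d) p))"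
proof -
  let ?P = "\<lambda>d p. projection (V d) (\<Phi> p (codiff M 4 (psi M) p))"
  let ?u = "\<lambda>d p. inv_into (V d) H (?P d p)"
  have P: "?P d p \<in> H ` V d" for d p
    using projection_in[OF subspace_V] bij_V by (simp add: bij_betw_def)
  have u: "?u d p \<in> V d" "H (?u d p) = ?P d p" for d p
    using inv_into_into[OF P] f_inv_into_f[OF P] by auto
  have "flux_form M p = (\<Sum>d\<in>ranks. \<Psi> p (?u d p))"
    by (rule flux_form_sum[OF finite_ranks subspace_V orthogonal_V span_V u])
  also have "\<dots> = (\<Sum>d\<in>ranks. inv_into (V_bundle M d p) (flux_op M p) (tau M (V_bundle M d) p))"
  proof (rule sum.cong[OF refl])
    fix d
    have uA: "?u d p \<in> A" using u(1) V_A by blast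
    have "tau M (V_bundle M d) p = flux_op M p (\<Psi> p (?u d p))"
      by (simp add: tau_eq[OF subspace_V V_A V_bundle_eq] flux_\<Psi>[OF uA] u(2))
    moreover have "\<Psi> p (?u d p) \<in> V_bundle M d p" using u(1) by (simp add: V_bundle_eq)
    moreover have "inj_on (flux_op M p) (V_bundle M d p)" using flux_V_bundle(2) by (simp add: bij_betw_def)
    ultimately show "\<Psi> p (?u d p) = inv_into (V_bundle M d p) (flux_op M p) (tau M (V_bundle M d) p)"
      by simp
  qed
  finally show ?thesis by (simp add: perp_ranks_eq)
qed

lemma multiplicity_free:
  fixes m :: nat
  assumes irr: "\<forall>j\<in>{1..m}. irreducible_subrep (grp M) 3 (W j)"
    and noniso: "\<forall>i\<in>{1..m}. \<forall>j\<in>{1..m}. i \<noteq> j \<longrightarrow> \<not> isomorphic_reps (grp M) (W i) (W j)"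
    and sum: "\<forall>p. is_direct_sum {1..m} (\<lambda>j. assoc_bundle M 3 (W j) p) (flux_ker_perp M p)"
  shows "\<exists>a :: nat \<Rightarrow> real.
     (\<forall>j\<in>{1..m}. a j \<noteq> 0 \<and> (\<forall>p. \<forall>\<xi>\<in>assoc_bundle M 3 (W j) p. flux_op M p \<xi> = a j *\<^sub>R \<xi>)) \<and>
     (\<forall>p. flux_form M p = (\<Sum>j\<in>{1..m}. (1 / a j) *\<^sub>R tau M (assoc_bundle M 3 (W j)) p))"
proof -
  have "\<forall>j\<in>{1..m}. \<exists>U. irreducible_rep U \<and> W j = D ` U" using irr irreducible_D by blast
  then obtain U where "\<forall>j\<in>{1..m}. irreducible_rep (U j) \<and> W j = D ` U j" by (rule bchoice[THEN exE])
  then have U: "irreducible_rep (U j)" "W j = D ` U j" if "j \<in> {1..m}" for j using that by blast+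
  have inv: "invariant (U j)" if "j \<in> {1..m}" for j using irreducible_invariant[OF U(1)[OF that]] .
  have sub: "subspace (U j)" and UA: "U j \<subseteq> A" if "j \<in> {1..m}" for j
    using inv[OF that] by (auto simp: invariant_def)
  have assoc: "assoc_bundle M 3 (W j) p = \<Psi> p ` U j" if "j \<in> {1..m}" for j p
    using U(2)[OF that] assoc_\<Psi>[OF inv[OF that]] by simp
  have span: "span (\<Union>j\<in>{1..m}. U j) = kernel_perp"
  proof -
    \<comment> \<open>The hypothesis on the fibre at any single point gives the decomposition of
      arrays, because \<open>\<Psi> p\<close> is injective on \<open>A\<close>.\<close>
    fix p :: 'm
    have "\<Psi> p ` span (\<Union>j\<in>{1..m}. U j) = span (\<Union>j\<in>{1..m}. assoc_bundle M 3 (W j) p)"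
      using assoc by (simp add: linear_span_image[OF linear_\<Psi>, symmetric] image_UN)
    also have "\<dots> = \<Psi> p ` kernel_perp"
      using is_direct_sum_span[OF sum[rule_format, of p]] by (simp add: flux_ker_perp_eq)
    finally have "\<Psi> p ` span (\<Union>j\<in>{1..m}. U j) = \<Psi> p ` kernel_perp" .
    moreover have "span (\<Union>j\<in>{1..m}. U j) \<subseteq> A" using UA by (intro span_minimal subspace_A) blast
    ultimately show ?thesis using inj_on_image_eq_iff[OF inj_\<Psi>] kernel_perp_A by blast
  qed
  have irrU: "\<forall>j\<in>{1..m}. irreducible_rep (U j)" using U(1) by blast
  have nonisoU: "\<forall>i\<in>{1..m}. \<forall>j\<in>{1..m}. i \<noteq> j \<longrightarrow>
      \<not> (\<exists>h. linear h \<and> bij_betw h (U i) (U j) \<and> (\<forall>g\<in>\<G>. \<forall>x\<in>U i. h (g x) = g (h x)))"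
  proof (intro ballI impI notI)
    fix i j
    assume ij: "i \<in> {1..m}" "j \<in> {1..m}" "i \<noteq> j"
      and "\<exists>h. linear h \<and> bij_betw h (U i) (U j) \<and> (\<forall>g\<in>\<G>. \<forall>x\<in>U i. h (g x) = g (h x))"
    then obtain h where h: "linear h" "bij_betw h (U i) (U j)" "\<forall>g\<in>\<G>. \<forall>x\<in>U i. h (g x) = g (h x)"
      by blast
    have "isomorphic_reps (grp M) (D ` U i) (D ` U j)"
      by (rule isomorphic_D[OF inv[OF ij(1)] inv[OF ij(2)] h(1,2)]) (use h(3) in blast)
    then have "isomorphic_reps (grp M) (W i) (W j)" by (simp only: U(2)[OF ij(1)] U(2)[OF ij(2)])
    then show False using noniso ij by blast
  qed
  note eig = eigenvalue_of_multiplicity_free[OF irrU nonisoU span]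
  have "\<forall>j\<in>{1..m}. \<exists>a. a \<noteq> 0 \<and> (\<forall>x\<in>U j. H x = a *\<^sub>R x)" by (intro ballI eig(2))
  then obtain a where "\<forall>j\<in>{1..m}. a j \<noteq> 0 \<and> (\<forall>x\<in>U j. H x = a j *\<^sub>R x)" by (rule bchoice[THEN exE])
  then have a: "a j \<noteq> 0" "\<And>x. x \<in> U j \<Longrightarrow> H x = a j *\<^sub>R x" if "j \<in> {1..m}" for j using that by blast+
  have "flux_op M p \<xi> = a j *\<^sub>R \<xi>" if j: "j \<in> {1..m}" and \<xi>: "\<xi> \<in> assoc_bundle M 3 (W j) p" for j p \<xi>
  proof -
    obtain x where x: "x \<in> U j" "\<xi> = \<Psi> p x" using \<xi> assoc[OF j] by blast
    then show ?thesis using UA[OF j] a(2)[OF j] by (simp add: flux_\<Psi> subset_iff linear_scale[OF linear_\<Psi>])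
  qed
  moreover have "flux_form M p = (\<Sum>j\<in>{1..m}. (1 / a j) *\<^sub>R tau M (assoc_bundle M 3 (W j)) p)" for p
  proof -
    let ?P = "\<lambda>j p. projection (U j) (\<Phi> p (codiff M 4 (psi M) p))"
    have P: "?P j p \<in> U j" if "j \<in> {1..m}" for j p by (rule projection_in[OF sub[OF that]])
    have "flux_form M p = (\<Sum>j\<in>{1..m}. \<Psi> p ((1 / a j) *\<^sub>R ?P j p))"
    proof (rule flux_form_sum[OF _ sub eig(1) span])
      fix j p assume j: "j \<in> {1..m}"
      show "(1 / a j) *\<^sub>R ?P j p \<in> U j" using P[OF j] by (intro subspace_scale[OF sub[OF j]])
      show "H ((1 / a j) *\<^sub>R ?P j p) = ?P j p"
        using a[OF j] P[OF j] by (simp add: linear_scale[OF linear_H])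
    qed auto
    also have "\<dots> = (\<Sum>j\<in>{1..m}. (1 / a j) *\<^sub>R tau M (assoc_bundle M 3 (W j)) p)"
    proof (rule sum.cong[OF refl])
      fix j assume j: "j \<in> {1..m}"
      show "\<Psi> p ((1 / a j) *\<^sub>R ?P j p) = (1 / a j) *\<^sub>R tau M (assoc_bundle M 3 (W j)) p"
        using tau_eq[where E = "assoc_bundle M 3 (W j)", OF sub[OF j] UA[OF j] assoc[OF j]]
        by (simp add: linear_scale[OF linear_\<Psi>])
    qed
    finally show ?thesis .
  qed
  ultimately show ?thesis using a(1) by (intro exI[of _ a]) blast
qed

end

section \<open>Frames of a 4-form geometry\<close>

lemma linear_on_combination:
  assumes "subspace T" "\<And>i. e i \<in> T"
    and "\<And>x y a b. x \<in> T \<Longrightarrow> y \<in> T \<Longrightarrow> f (a *\<^sub>R x + b *\<^sub>R y) = a * f x + b * (f y :: real)"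
  shows "f (\<Sum>k\<in>S. c k *\<^sub>R e k) = (\<Sum>k\<in>S. c k * f (e k))"
proof (induction S rule: infinite_finite_induct)
  case (insert k S)
  have "(\<Sum>k\<in>S. c k *\<^sub>R e k) \<in> T"
    using assms(2) by (intro subspace_sum[OF assms(1)] subspace_scale[OF assms(1)]) auto
  then show ?case using insert assms(3)[OF assms(2)[of k], of "\<Sum>k\<in>S. c k *\<^sub>R e k" "c k" 1] by simp
qed (use assms(3)[of 0 0 0 0] subspace_0[OF assms(1)] in auto)

lemma (in framed_space) co_combination: "co i (\<Sum>k\<in>UNIV. c k *\<^sub>R e k) = c i"
proof -
  have "co i (\<Sum>k\<in>UNIV. c k *\<^sub>R e k) = (\<Sum>k\<in>UNIV. c k * co i (e k))"
    by (rule linear_on_combination[OF subspace_T frame_in co_linear])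
  also have "\<dots> = c i" by (simp add: co_frame if_distrib cong: if_cong)
  finally show ?thesis .
qed

text \<open>The model space on which subrepresentations are defined; its \<open>form_of\<close>
  later plays the role of \<open>D\<close> in \<open>fibre_model\<close>.\<close>

interpretation std: framed_space UNIV "\<lambda>i. axis i 1 :: real^'n" "\<lambda>i x. x$i"
proof
  show "x = (\<Sum>i\<in>UNIV. x$i *\<^sub>R axis i 1)" for x :: "real^'n"
    using basis_expansion[of x] by (simp add: scalar_mult_eq_scaleR)
qed (auto simp: axis_def)

lemma components_frame_pullback:
  fixes e :: "'n::finite \<Rightarrow> 'v::real_vector"
  shows "frame_components (\<lambda>i. axis i 1) (frame_pullback e \<omega>) = frame_components e \<omega>"
proof -
  have "(\<Sum>k\<in>UNIV. (axis i 1 :: real^'n) $ k *\<^sub>R e k) = e i" for i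
    by (simp add: axis_def if_distrib[of "\<lambda>c. c *\<^sub>R _"] cong: if_cong)
  then show ?thesis by (simp add: frame_components_def frame_pullback_def)
qed

lemma (in framed_space) frame_pullback_form_of: "frame_pullback e (form_of x) = std.form_of x"
proof
  fix vs :: "(real^'n) list"
  let ?f = "\<lambda>x. \<Sum>i\<in>UNIV. (x$i) *\<^sub>R e i"
  have "?f v \<in> T" for v
    using frame_in by (intro subspace_sum[OF subspace_T] subspace_scale[OF subspace_T]) auto
  then have "set (map ?f vs) \<subseteq> T" by auto
  moreover have "co i (map ?f vs ! k) = vs ! k $ i" if "k < length vs" for i k
    using that by (simp add: co_combination)
  ultimately show "frame_pullback e (form_of x) vs = std.form_of x vs"
    by (simp add: frame_pullback_def form_of_def std.form_of_def)
qed

lemma frame_act_axis: "frame_act (\<lambda>i. axis i 1) B = (\<lambda>j. B *v axis j 1)"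
proof
  fix j
  show "frame_act (\<lambda>i. axis i 1) B j = B *v axis j 1"
    using std.frame_expansion[of "column j B"]
    by (simp add: frame_act_def matrix_vector_mult_basis column_def)
qed

text \<open>Evaluating \<open>act A \<alpha>\<close> on the standard basis is evaluating
  \<open>\<alpha>\<close> on the columns of the inverse of \<open>A\<close>, which is a change of
  frame.\<close>

lemma components_act:
  assumes "\<alpha> \<in> alt_forms UNIV 3"
  shows "frame_components (\<lambda>i. axis i 1) (act A \<alpha>) = transform_array (matrix_inv A) (frame_components (\<lambda>i. axis i 1) \<alpha>)"
proof -
  have "frame_components (\<lambda>i. axis i 1) (act A \<alpha>) = frame_components (frame_act (\<lambda>i. axis i 1) (matrix_inv A)) \<alpha>"
    by (simp add: frame_components_def act_def frame_act_axis)
  then show ?thesis by (simp add: components_frame_act[OF assms])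
qed

text \<open>Read off from forms: the transformed array consists of the components of an alternating
  form in another frame.\<close>

lemma transform_array_alternating:
  assumes "x \<in> alternating_arrays"
  shows "transform_array Q x \<in> alternating_arrays"
  using components_alternating[OF std.form_of_alt_forms[OF assms], of "frame_act (\<lambda>i. axis i 1) Q"]
  by (simp add: components_frame_act[OF std.form_of_alt_forms[OF assms]] std.components_form_of)

lemma matrix_inv_orthogonal:
  fixes A :: "real^'n^'n"
  assumes "orthogonal_matrix A"
  shows "matrix_inv A = transpose A"
proof -
  have A: "A ** transpose A = mat 1" "transpose A ** A = mat 1"
    using assms by (auto simp: orthogonal_matrix_def)
  then have "\<exists>B. A ** B = mat 1 \<and> B ** A = mat 1" by blast
  then have "A ** matrix_inv A = mat 1" unfolding matrix_inv_def by (rule someI2_ex) blast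
  then have "transpose A ** (A ** matrix_inv A) = transpose A" by simp
  then show ?thesis by (simp add: matrix_mul_assoc A)
qed

text \<open>The codomain will be a space of forms, which is only a real vector space, so the
  dimension is counted on the image of a basis.\<close>

lemma dim_linear_image_inj_on:
  fixes f :: "'a::euclidean_space \<Rightarrow> 'b::real_vector"
  assumes "linear f" "inj_on f U" "subspace U"
  shows "dim (f ` U) = dim U"
proof -
  obtain B where B: "B \<subseteq> U" "independent B" "U \<subseteq> span B" "card B = dim U"
    by (rule basis_exists[of U])
  have sp: "span B = U" using span_minimal[OF B(1) assms(3)] B(3) by (rule subset_antisym)
  have inj: "inj_on f (span B)" using assms(2) sp by simp
  have "independent (f ` B)" by (rule linear_independent_injective_image[OF assms(1) B(2) inj])
  moreover have "span (f ` B) = f ` U" by (simp add: linear_span_image[OF assms(1)] sp)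
  moreover have "card (f ` B) = dim U"
    using card_image[OF inj_on_subset[OF assms(2) B(1)]] B(4) by simp
  ultimately show ?thesis using dim_eq_card[of "f ` B" "f ` U"] span_span by metis
qed

lemma sum_lists_length_3:
  "(\<Sum>xs | length xs = 3. f xs) = (\<Sum>i\<in>UNIV. \<Sum>j\<in>UNIV. \<Sum>k\<in>UNIV. f [i, j, k])"
  for f :: "'n::finite list \<Rightarrow> real"
proof -
  have "(\<Sum>xs | length xs = 3. f xs) = (\<Sum>(i, j, k)\<in>UNIV. f [i, j, k])"
    by (rule sum.reindex_bij_witness[of _ "\<lambda>(i, j, k). [i, j, k]" "\<lambda>xs. (xs ! 0, xs ! 1, xs ! 2)"])
       (auto dest!: length_3_cases simp: numeral_2_eq_2)
  then show ?thesis
    by (simp add: UNIV_Times_UNIV[symmetric] sum.cartesian_product[symmetric] del: UNIV_Times_UNIV)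
qed

section \<open>Tangent spaces and their orthonormal frames\<close>

lemma linear_jac:
  assumes "oriented_smooth_atlas \<A>" "c \<in> \<A>" "c' \<in> \<A>" "p \<in> cdom c" "p \<in> cdom c'"
  shows "linear (jac c c' p)"
proof -
  have "smooth_on (cmap c ` (cdom c \<inter> cdom c')) (cmap c' \<circ> cinv c)"
    using assms by (simp add: oriented_smooth_atlas_def)
  then have "Ck_on (Suc 0) (cmap c ` (cdom c \<inter> cdom c')) (cmap c' \<circ> cinv c)"
    unfolding smooth_on_def by blast
  then have "\<forall>x\<in>cmap c ` (cdom c \<inter> cdom c'). (cmap c' \<circ> cinv c) differentiable (at x)"
    unfolding Ck_on.simps by (rule conjunct1)
  then have "(cmap c' \<circ> cinv c) differentiable (at (cmap c p))"
    using assms(4,5) by blast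
  then show ?thesis unfolding jac_def by (rule linear_frechet_derivative)
qed

lemma tangentI:
  assumes "\<And>c. \<not> (c \<in> atlas M \<and> p \<in> cdom c) \<Longrightarrow> v c = 0"
    and "\<And>c c'. c \<in> atlas M \<Longrightarrow> c' \<in> atlas M \<Longrightarrow> p \<in> cdom c \<Longrightarrow> p \<in> cdom c' \<Longrightarrow> v c' = jac c c' p (v c)"
  shows "v \<in> tangent M p"
  using assms unfolding tangent_def by blast

lemma tangentD:
  assumes "v \<in> tangent M p"
  shows "\<not> (c \<in> atlas M \<and> p \<in> cdom c) \<Longrightarrow> v c = 0"
    and "c \<in> atlas M \<Longrightarrow> c' \<in> atlas M \<Longrightarrow> p \<in> cdom c \<Longrightarrow> p \<in> cdom c' \<Longrightarrow> v c' = jac c c' p (v c)"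
  using assms unfolding tangent_def by blast+

lemma subspace_tangent:
  assumes "oriented_smooth_atlas (atlas M)"
  shows "subspace (tangent M p)"
proof (rule subspaceI)
  note J = linear_jac[OF assms]
  show "0 \<in> tangent M p" by (rule tangentI) (simp_all add: linear_0[OF J])
  fix u v assume uv: "u \<in> tangent M p" "v \<in> tangent M p"
  show "u + v \<in> tangent M p"
  proof (rule tangentI)
    fix c c' assume c: "c \<in> atlas M" "c' \<in> atlas M" "p \<in> cdom c" "p \<in> cdom c'"
    show "(u + v) c' = jac c c' p ((u + v) c)"
      unfolding plus_fun_apply tangentD(2)[OF uv(1) c] tangentD(2)[OF uv(2) c] linear_add[OF J[OF c]] ..
  qed (use tangentD(1)[OF uv(1)] tangentD(1)[OF uv(2)] in auto)
next
  note J = linear_jac[OF assms]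
  fix r :: real and v assume v: "v \<in> tangent M p"
  show "r *\<^sub>R v \<in> tangent M p"
  proof (rule tangentI)
    fix c c' assume c: "c \<in> atlas M" "c' \<in> atlas M" "p \<in> cdom c" "p \<in> cdom c'"
    show "(r *\<^sub>R v) c' = jac c c' p ((r *\<^sub>R v) c)"
      unfolding scaleR_fun_def tangentD(2)[OF v c] linear_scale[OF J[OF c]] ..
  qed (use tangentD(1)[OF v] in \<open>auto simp: scaleR_fun_def\<close>)
qed

text \<open>In one chart the frame has positive determinant, so the coordinates of \<open>v\<close>
  can be solved for there; the linear derivatives of the coordinate changes carry this expansion to
  all other charts, and orthonormality identifies its coefficients with the metric products.\<close>

lemma framed_tangent:
  fixes M :: "('m::topological_space, 'n::finite) geometry"
  assumes atlas: "oriented_smooth_atlas (atlas M)" and metric: "riemannian_metric M"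
    and e: "e \<in> oriented_orthonormal_frames M p"
  shows "framed_space (tangent M p) e (\<lambda>i. metric M p (e i))"
proof
  show T: "subspace (tangent M p)" by (rule subspace_tangent[OF atlas])
  show eT: "e i \<in> tangent M p" for i using e by (simp add: oriented_orthonormal_frames_def)
  show lin: "metric M p (e i) (a *\<^sub>R x + b *\<^sub>R y) = a * metric M p (e i) x + b * metric M p (e i) y"
    if xy: "x \<in> tangent M p" "y \<in> tangent M p" for x y i a b
  proof -
    have sym: "metric M p (e i) v = metric M p v (e i)" if "v \<in> tangent M p" for v
      using metric eT[of i] that unfolding riemannian_metric_def by blast
    have "a *\<^sub>R x + b *\<^sub>R y \<in> tangent M p"
      using xy by (intro subspace_add[OF T] subspace_scale[OF T])
    moreover have "metric M p (a *\<^sub>R x + b *\<^sub>R y) (e i) = a * metric M p x (e i) + b * metric M p y (e i)"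
      using metric eT[of i] xy unfolding riemannian_metric_def by blast
    ultimately show ?thesis using sym xy by simp
  qed
  show orth: "metric M p (e i) (e j) = (if i = j then 1 else 0)" for i j
    using e by (simp add: oriented_orthonormal_frames_def)
  fix v assume v: "v \<in> tangent M p"
  obtain c where c: "c \<in> atlas M" "p \<in> cdom c"
    using atlas unfolding oriented_smooth_atlas_def by blast
  let ?B = "\<chi> i j. e j c $ i"
  have "det ?B \<noteq> 0" using e c by (force simp: oriented_orthonormal_frames_def)
  then obtain B' where B': "?B ** B' = mat 1" using invertible_det_nz[of ?B] unfolding invertible_def by blast
  define x where "x = B' *v v c"
  have "?B *v x = v c" by (simp add: x_def matrix_vector_mul_assoc B')
  then have vc: "(\<Sum>j\<in>UNIV. x$j *\<^sub>R e j c) = v c"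
    by (simp add: matrix_vector_mult_def vec_eq_iff mult.commute)
  have v_eq: "v = (\<Sum>j\<in>UNIV. x$j *\<^sub>R e j)"
  proof
    fix c'
    show "v c' = (\<Sum>j\<in>UNIV. x$j *\<^sub>R e j) c'"
    proof (cases "c' \<in> atlas M \<and> p \<in> cdom c'")
      case True
      have J: "linear (jac c c' p)" using linear_jac[OF atlas] c True by blast
      have jac: "w c' = jac c c' p (w c)" if "w \<in> tangent M p" for w
        using tangentD(2)[OF that] c True by blast
      have "v c' = jac c c' p (\<Sum>j\<in>UNIV. x$j *\<^sub>R e j c)" using jac[OF v] vc by simp
      also have "\<dots> = (\<Sum>j\<in>UNIV. x$j *\<^sub>R e j c')"
        by (simp add: linear_sum[OF J] linear_scale[OF J] jac[OF eT])
      finally show ?thesis by (simp add: sum_fun_apply scaleR_fun_def)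
    next
      case False
      then have "w c' = 0" if "w \<in> tangent M p" for w by (rule tangentD(1)[OF that])
      from this[OF v] this[OF eT] show ?thesis by (simp add: sum_fun_apply scaleR_fun_def)
    qed
  qed
  have "metric M p (e i) (\<Sum>j\<in>UNIV. x$j *\<^sub>R e j) = (\<Sum>j\<in>UNIV. x$j * metric M p (e i) (e j))" for i
    by (rule linear_on_combination[OF T, where f = "metric M p (e i)"]) (simp_all add: eT lin)
  then have "metric M p (e i) v = x$i" for i
    by (simp add: v_eq orth if_distrib cong: if_cong)
  then show "v = (\<Sum>i\<in>UNIV. metric M p (e i) v *\<^sub>R e i)" using v_eq by simp
qed

lemma orthonormal_frame_change:
  fixes M :: "('m::topological_space, 'n::finite) geometry"
  assumes atlas: "oriented_smooth_atlas (atlas M)" and metric: "riemannian_metric M"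
    and e: "e \<in> oriented_orthonormal_frames M p" and f: "f \<in> oriented_orthonormal_frames M p"
  shows "\<exists>Q. orthogonal_matrix Q \<and> f = frame_act e Q"
proof -
  interpret e: framed_space "tangent M p" e "\<lambda>i. metric M p (e i)"
    by (rule framed_tangent[OF atlas metric e])
  interpret f: framed_space "tangent M p" f "\<lambda>i. metric M p (f i)"
    by (rule framed_tangent[OF atlas metric f])
  define Q where "Q = (\<chi> i j. metric M p (e i) (f j))"
  have fQ: "f = frame_act e Q"
    unfolding frame_act_def Q_def using e.frame_expansion[OF f.frame_in] by (simp add: fun_eq_iff)
  have sym: "metric M p u v = metric M p v u" if "u \<in> tangent M p" "v \<in> tangent M p" for u v
    using metric that unfolding riemannian_metric_def by blast
  have "(\<Sum>i\<in>UNIV. Q$i$j * Q$i$k) = (if j = k then 1 else 0)" for j k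
  proof -
    have "(if j = k then 1 else 0) = metric M p (f j) (f k)" by (simp add: f.co_frame)
    also have "f k = (\<Sum>i\<in>UNIV. Q$i$k *\<^sub>R e i)" using fQ by (simp add: frame_act_def)
    also have "metric M p (f j) \<dots> = (\<Sum>i\<in>UNIV. Q$i$k * metric M p (f j) (e i))"
      by (rule linear_on_combination[OF e.subspace_T, where f = "metric M p (f j)"])
         (simp_all add: e.frame_in f.co_linear)
    also have "\<dots> = (\<Sum>i\<in>UNIV. Q$i$j * Q$i$k)"
      by (simp add: Q_def sym[OF f.frame_in e.frame_in] mult.commute)
    finally show ?thesis ..
  qed
  then have "orthogonal_matrix Q"
    by (simp add: orthogonal_matrix matrix_matrix_mult_def transpose_def mat_def vec_eq_iff)
  then show ?thesis using fQ by blast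
qed

section \<open>The array model of a given 4-form geometry\<close>

locale flux_geometry =
  fixes M :: "('m::{t2_space,second_countable_topology}, 'n::{finite,linorder}) geometry"
    and \<psi>\<^sub>0 :: "(real, 'n) vec form"
  assumes four_form_geometry: "four_form_geometry M"
    and psi0: "\<psi>\<^sub>0 \<in> alt_forms UNIV 4"
    and pullback_psi: "e \<in> frames M p \<Longrightarrow> frame_pullback e (psi M p) = \<psi>\<^sub>0"
begin

definition frame :: "'m \<Rightarrow> 'n \<Rightarrow> ('m, 'n) tvec" where
  "frame p = (SOME e. e \<in> frames M p)"

definition change :: "'m \<Rightarrow> ((real, 'n) vec, 'n) vec" where
  "change p = (SOME Q. orthogonal_matrix Q \<and> frame p = frame_act (onb M p) Q)"

definition from_array :: "'m \<Rightarrow> (((real, 'n) vec, 'n) vec, 'n) vec \<Rightarrow> ('m, 'n) tvec form" where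
  "from_array p = framed_space.form_of (tangent M p) (\<lambda>i. metric M p (frame p i))"

text \<open>
  On arbitrary functions of lists, which the codifferential is not yet known to be better than,
  only the components in the frame \<open>onb M p\<close> are controlled by \<open>form_inner\<close>; on forms
  \<open>to_array p\<close> gives the components in the frame \<open>frame p\<close>.
\<close>

definition to_array :: "'m \<Rightarrow> ('m, 'n) tvec form \<Rightarrow> (((real, 'n) vec, 'n) vec, 'n) vec" where
  "to_array p \<omega> = transform_array (change p) (frame_components (onb M p) \<omega>)"

definition coeffs :: "'n \<Rightarrow> 'n \<Rightarrow> 'n \<Rightarrow> 'n \<Rightarrow> real" where
  "coeffs i j k l = \<psi>\<^sub>0 [axis i 1, axis j 1, axis k 1, axis l 1]"

lemma atlas: "oriented_smooth_atlas (atlas M)" and metric: "riemannian_metric M"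
  and group: "closed_subgroup_SO (grp M)" and reduction: "G_structure M"
  and psi: "psi M p \<in> forms_at M 4 p"
  using four_form_geometry by (simp_all add: four_form_geometry_def smooth_form_def)

lemma subspace_T: "subspace (tangent M p)"
  by (rule subspace_tangent[OF atlas])

lemma frame: "frame p \<in> frames M p"
proof -
  have "\<exists>e. e \<in> frames M p" using reduction unfolding G_structure_def by meson
  then show ?thesis unfolding frame_def by (rule someI_ex)
qed

lemma frames_orthonormal: "e \<in> frames M p \<Longrightarrow> e \<in> oriented_orthonormal_frames M p"
  using reduction unfolding G_structure_def by blast

lemma frames_eq: "e \<in> frames M p \<Longrightarrow> frames M p = frame_act e ` grp M"
  using reduction unfolding G_structure_def by blast

lemma onb: "onb M p \<in> oriented_orthonormal_frames M p"
  unfolding onb_def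
  by (rule someI[of "\<lambda>e. e \<in> oriented_orthonormal_frames M p", OF frames_orthonormal[OF frame]])

lemma change: "orthogonal_matrix (change p)" "frame p = frame_act (onb M p) (change p)"
proof -
  have "\<exists>Q. orthogonal_matrix Q \<and> frame p = frame_act (onb M p) Q"
    by (rule orthonormal_frame_change[OF atlas metric onb frames_orthonormal[OF frame]])
  from someI_ex[OF this] show "orthogonal_matrix (change p)" "frame p = frame_act (onb M p) (change p)"
    unfolding change_def by blast+
qed

lemma framed: "e \<in> frames M p \<Longrightarrow> framed_space (tangent M p) e (\<lambda>i. metric M p (e i))"
  by (rule framed_tangent[OF atlas metric frames_orthonormal])

lemma onb_tangent: "onb M p i \<in> tangent M p"
  using onb by (simp add: oriented_orthonormal_frames_def)

sublocale fr: framed_space "tangent M p" "frame p" "\<lambda>i. metric M p (frame p i)"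
  rewrites "framed_space.form_of (tangent M p) (\<lambda>i. metric M p (frame p i)) = from_array p"
  by (rule framed[OF frame]) (simp add: from_array_def)

lemma to_array_eq: "\<omega> \<in> forms_at M 3 p \<Longrightarrow> to_array p \<omega> = frame_components (frame p) \<omega>"
  by (simp add: to_array_def change(2) components_frame_act[OF _ subspace_T onb_tangent])

lemma group_orthogonal: "A \<in> grp M \<Longrightarrow> orthogonal_matrix A"
  using group by (auto simp: closed_subgroup_SO_def SO_def)

lemma group_inv: "A \<in> grp M \<Longrightarrow> matrix_inv A \<in> grp M"
  using group by (auto simp: closed_subgroup_SO_def)

lemma group_inv_inv: "A \<in> grp M \<Longrightarrow> matrix_inv (matrix_inv A) = A"
  using group_orthogonal[of A] group_orthogonal[OF group_inv, of A] by (simp add: matrix_inv_orthogonal)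

lemma coeffs_frame:
  assumes "e \<in> frames M p"
  shows "(\<lambda>i j k l. psi M p [e i, e j, e k, e l]) = coeffs"
proof -
  have "(\<Sum>k\<in>UNIV. (axis i 1 :: (real, 'n) vec) $ k *\<^sub>R e k) = e i" for i
    by (simp add: axis_def if_distrib[of "\<lambda>c. c *\<^sub>R _"] cong: if_cong)
  then have "frame_pullback e (psi M p) [axis i 1, axis j 1, axis k 1, axis l 1] = psi M p [e i, e j, e k, e l]"
    for i j k l by (simp add: frame_pullback_def)
  then have "coeffs i j k l = psi M p [e i, e j, e k, e l]" for i j k l
    unfolding coeffs_def pullback_psi[OF assms] .
  then show ?thesis by (simp add: fun_eq_iff)
qed

text \<open>The exchange of pairs is even, a product of four adjacent transpositions: ijkl, ikjl,
  kijl, kilj, klij.\<close>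

lemma coeffs_symmetric: "coeffs i j k l = coeffs k l i j"
proof -
  note sw = alt_forms_swap4[OF psi0 subspace_UNIV]
  let ?a = "\<lambda>i. axis i 1 :: (real, 'n) vec"
  show ?thesis
    unfolding coeffs_def
    using sw(2)[of "?a i" "?a j" "?a k" "?a l"] sw(1)[of "?a i" "?a k" "?a j" "?a l"]
      sw(3)[of "?a k" "?a i" "?a j" "?a l"] sw(2)[of "?a k" "?a i" "?a l" "?a j"] by linarith
qed

lemma components_frame_flux_frames:
  "e \<in> frames M p \<Longrightarrow> frame_components e (frame_flux e (psi M p) \<xi>) = array_flux coeffs (frame_components e \<xi>)"
  by (simp add: components_frame_flux[OF psi subspace_T] coeffs_frame)

lemma frame_flux_forms:
  "\<xi> \<in> forms_at M 3 p \<Longrightarrow> frame_flux (frame p) (psi M p) \<xi> \<in> forms_at M 3 p"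
  by (rule frame_flux_alt_forms[OF psi _ subspace_T fr.frame_in])

text \<open>The form action \<open>act A\<close> corresponds to
  \<open>transform_array (matrix_inv A)\<close>; closure of the group under inverses makes the two
  families of maps have the same invariant subspaces.\<close>

sublocale rep: orthogonal_rep alternating_arrays "transform_array ` grp M"
  by (rule orthogonal_rep.intro)
     (auto simp: subspace_alternating_arrays linear_transform_array inner_transform_array
       group_orthogonal transform_array_alternating)

text \<open>
  Equivariance of the flux operator is independence of the frame: \<open>\<psi>\<close> has the same coefficients
  in all frames of the \<open>G\<close>-structure.
\<close>

lemma array_flux_transform:
  assumes A: "A \<in> grp M" and x: "x \<in> alternating_arrays"
  shows "array_flux coeffs (transform_array A x) = transform_array A (array_flux coeffs x)"
proof -
  fix p :: 'm
  let ?e = "frame p" and ?f = "frame_act (frame p) A" and ?\<omega> = "from_array p x"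
  have f: "?f \<in> frames M p" using frames_eq[OF frame] A by blast
  have \<omega>: "?\<omega> \<in> forms_at M 3 p" by (rule fr.form_of_alt_forms[OF x])
  note tr = components_frame_act[OF _ subspace_T fr.frame_in]
  have flux: "frame_flux ?f (psi M p) ?\<omega> = frame_flux ?e (psi M p) ?\<omega>"
    by (rule frame_flux_frame_act[OF group_orthogonal[OF A] psi \<omega> subspace_T fr.frame_in])
  have "array_flux coeffs (transform_array A x) = array_flux coeffs (frame_components ?f ?\<omega>)"
    by (simp add: tr[OF \<omega>] fr.components_form_of)
  also have "\<dots> = frame_components ?f (frame_flux ?e (psi M p) ?\<omega>)"
    unfolding flux[symmetric] by (rule components_frame_flux_frames[OF f, symmetric])
  also have "\<dots> = transform_array A (frame_components ?e (frame_flux ?e (psi M p) ?\<omega>))"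
    by (rule tr[OF frame_flux_forms[OF \<omega>]])
  also have "\<dots> = transform_array A (array_flux coeffs x)"
    by (simp add: components_frame_flux_frames[OF frame] fr.components_form_of)
  finally show ?thesis .
qed

lemma array_flux_alternating:
  assumes "x \<in> alternating_arrays"
  shows "array_flux coeffs x \<in> alternating_arrays"
proof -
  fix p :: 'm
  have "frame_components (frame p) (frame_flux (frame p) (psi M p) (from_array p x)) \<in> alternating_arrays"
    by (intro components_alternating[OF _ subspace_T[of p]] frame_flux_forms fr.form_of_alt_forms assms)
  then show ?thesis by (simp add: components_frame_flux_frames[OF frame] fr.components_form_of)
qed

sublocale rep: self_adjoint_intertwiner alternating_arrays "transform_array ` grp M" "array_flux coeffs"
proof (intro self_adjoint_intertwiner.intro self_adjoint_intertwiner_axioms.intro rep.orthogonal_rep_axioms)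
  show "array_flux coeffs x \<bullet> y = x \<bullet> array_flux coeffs y"
    if "x \<in> alternating_arrays" "y \<in> alternating_arrays" for x y
    by (rule array_flux_self_adjoint[OF that coeffs_symmetric])
qed (auto simp: linear_array_flux array_flux_alternating array_flux_transform)

abbreviation components_std :: "((real, 'n) vec) form \<Rightarrow> (((real, 'n) vec, 'n) vec, 'n) vec" where
  "components_std \<equiv> frame_components (\<lambda>i. axis i 1)"

lemma components_subrep:
  assumes "subrep (grp M) 3 W"
  shows "rep.invariant (components_std ` W)" "W = std.form_of ` components_std ` W"
proof -
  have W: "subspace W" "W \<subseteq> alt_forms UNIV 3" "\<And>A \<alpha>. A \<in> grp M \<Longrightarrow> \<alpha> \<in> W \<Longrightarrow> act A \<alpha> \<in> W"
    using assms by (auto simp: subrep_def)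
  have "transform_array A (components_std \<alpha>) \<in> components_std ` W" if "A \<in> grp M" "\<alpha> \<in> W" for A \<alpha>
  proof -
    have "\<alpha> \<in> alt_forms UNIV 3" using that(2) W(2) by blast
    from components_act[OF this, of "matrix_inv A"]
    have "transform_array A (components_std \<alpha>) = components_std (act (matrix_inv A) \<alpha>)"
      by (simp only: group_inv_inv[OF that(1)])
    then show ?thesis using W(3)[OF group_inv[OF that(1)] that(2)] by simp
  qed
  then show "rep.invariant (components_std ` W)"
    using linear_subspace_image[OF linear_components W(1)]
      components_alternating[OF subsetD[OF W(2)] subspace_UNIV]
    by (auto simp: rep.invariant_def)
  have "std.form_of (components_std \<alpha>) = \<alpha>" if "\<alpha> \<in> W" for \<alpha>
    using std.form_of_components W(2) that by blast
  then have "(\<lambda>\<alpha>. std.form_of (components_std \<alpha>)) ` W = (\<lambda>\<alpha>. \<alpha>) ` W" by (rule image_cong[OF refl])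
  then show "W = std.form_of ` components_std ` W" by (simp add: image_image)
qed

lemma components_form_of_image: "components_std ` std.form_of ` U = U"
  by (simp add: image_image std.components_form_of)

lemma act_form_of:
  assumes "x \<in> alternating_arrays" "A \<in> grp M"
  shows "act A (std.form_of x) = std.form_of (transform_array (matrix_inv A) x)"
proof -
  have alt: "std.form_of x \<in> alt_forms UNIV 3" by (rule std.form_of_alt_forms[OF assms(1)])
  let ?B = "matrix_inv A"
  have "act A (std.form_of x) \<in> alt_forms UNIV 3"
  proof (rule alt_forms_3I)
    note sw = alt_forms_swap3[OF alt subspace_UNIV]
    show "act A (std.form_of x) [u, v, w] = - act A (std.form_of x) [v, u, w]" for u v w
      using sw(1)[of "?B *v u" "?B *v v" "?B *v w"] by (simp add: act_def)
    show "act A (std.form_of x) [u, v, w] = - act A (std.form_of x) [u, w, v]" for u v w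
      using sw(2)[of "?B *v u" "?B *v v" "?B *v w"] by (simp add: act_def)
    show "act A (std.form_of x) [a *\<^sub>R u + b *\<^sub>R u', v, w] =
        a * act A (std.form_of x) [u, v, w] + b * act A (std.form_of x) [u', v, w]" for u u' v w a b
      using alt_forms_linear[OF alt, of "[?B *v u, ?B *v v, ?B *v w]" 0 "?B *v u" "?B *v u'" a b]
      by (simp add: act_def matrix_vector_right_distrib matrix_vector_mult_scaleR)
  qed (simp add: act_def std.form_of_def)
  from std.form_of_components[OF this]
  have "act A (std.form_of x) = std.form_of (components_std (act A (std.form_of x)))" by (rule sym)
  also have "\<dots> = std.form_of (transform_array ?B x)"
    unfolding components_act[OF alt] std.components_form_of ..
  finally show ?thesis .
qed

lemma form_of_invariant:
  assumes "rep.invariant U"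
  shows "subrep (grp M) 3 (std.form_of ` U)"
  using assms linear_subspace_image[OF std.linear_form_of, of U] std.form_of_alt_forms
  by (auto simp: subrep_def rep.invariant_def act_form_of group_inv subset_iff)

lemma irreducible_iff:
  "irreducible_subrep (grp M) 3 W \<longleftrightarrow> (\<exists>U. rep.irreducible_rep U \<and> W = std.form_of ` U)"
proof
  have zero: "components_std 0 = 0" "std.form_of (0 :: (((real, 'n) vec, 'n) vec, 'n) vec) = 0"
    by (simp_all add: linear_0[OF linear_components] linear_0[OF std.linear_form_of])
  show "\<exists>U. rep.irreducible_rep U \<and> W = std.form_of ` U" if W: "irreducible_subrep (grp M) 3 W"
  proof (intro exI[of _ "components_std ` W"] conjI)
    have sub: "subrep (grp M) 3 W" using W by (simp add: irreducible_subrep_def)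
    note CW = components_subrep[OF sub]
    show "W = std.form_of ` components_std ` W" by (rule CW(2))
    have "U = {0} \<or> U = components_std ` W" if U: "rep.invariant U" "U \<subseteq> components_std ` W" for U
    proof -
      have "std.form_of ` U \<subseteq> W" using U(2) CW(2) by blast
      then have "std.form_of ` U = {0} \<or> std.form_of ` U = W"
        using W form_of_invariant[OF U(1)] by (simp add: irreducible_subrep_def)
      then show ?thesis using components_form_of_image[of U] zero(1) by auto
    qed
    moreover have "components_std ` W \<noteq> {0}"
      using CW(2) zero(2) W by (auto simp: irreducible_subrep_def)
    ultimately show "rep.irreducible_rep (components_std ` W)"
      using CW(1) by (simp add: rep.irreducible_rep_def)
  qed
  assume "\<exists>U. rep.irreducible_rep U \<and> W = std.form_of ` U"
  then obtain U where U: "rep.irreducible_rep U" and W: "W = std.form_of ` U" by blast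
  have inv: "rep.invariant U" using U by (simp add: rep.irreducible_rep_def)
  have "X = {0} \<or> X = W" if X: "subrep (grp M) 3 X" "X \<subseteq> W" for X
  proof -
    note CX = components_subrep[OF X(1)]
    have "components_std ` X \<subseteq> U" using X(2) W components_form_of_image[of U] by blast
    then have "components_std ` X = {0} \<or> components_std ` X = U"
      using U CX(1) by (simp add: rep.irreducible_rep_def)
    then show ?thesis using CX(2) W zero(2) by auto
  qed
  moreover have "W \<noteq> {0}"
    using W components_form_of_image[of U] zero(1) U by (auto simp: rep.irreducible_rep_def)
  ultimately show "irreducible_subrep (grp M) 3 W"
    using form_of_invariant[OF inv] W by (simp add: irreducible_subrep_def)
qed

text \<open>Membership in the associated bundle is witnessed by some frame of the G-structure. It
  differs from \<open>frame p\<close> by an element of the group, which maps the invariant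
  \<open>U\<close> bijectively to itself, so the frame \<open>frame p\<close> is a witness
  too.\<close>

lemma assoc_bundle_eq:
  assumes "rep.invariant U"
  shows "assoc_bundle M 3 (std.form_of ` U) p = from_array p ` U"
proof
  have UA: "U \<subseteq> alternating_arrays" using assms by (simp add: rep.invariant_def)
  show "from_array p ` U \<subseteq> assoc_bundle M 3 (std.form_of ` U) p"
    using frame fr.frame_pullback_form_of fr.form_of_alt_forms UA
    by (fastforce simp: assoc_bundle_def)
  show "assoc_bundle M 3 (std.form_of ` U) p \<subseteq> from_array p ` U"
  proof
    fix \<xi> assume "\<xi> \<in> assoc_bundle M 3 (std.form_of ` U) p"
    then obtain f u where \<xi>: "\<xi> \<in> forms_at M 3 p" and f: "f \<in> frames M p" and u: "u \<in> U"
        and pull: "frame_pullback f \<xi> = std.form_of u"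
      by (auto simp: assoc_bundle_def)
    obtain A where A: "A \<in> grp M" "f = frame_act (frame p) A" using frames_eq[OF frame] f by blast
    have "transform_array A (frame_components (frame p) \<xi>) = frame_components f \<xi>"
      by (simp add: A(2) components_frame_act[OF \<xi> subspace_T fr.frame_in])
    also have "\<dots> = components_std (frame_pullback f \<xi>)" by (simp add: components_frame_pullback)
    also have "\<dots> = u" by (simp add: pull std.components_form_of)
    finally have *: "transform_array A (frame_components (frame p) \<xi>) = u" .
    have g: "transform_array A \<in> transform_array ` grp M" using A(1) by blast
    have "u \<in> transform_array A ` U" using rep.image_G[OF assms g] u by simp
    then have "frame_components (frame p) \<xi> \<in> U" using * injD[OF rep.inj_G[OF g]] by (metis imageE)
    then show "\<xi> \<in> from_array p ` U" using fr.form_of_components[OF \<xi>] by (metis imageI)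
  qed
qed

lemma isomorphic_form_of:
  assumes U: "rep.invariant U" and U': "rep.invariant U'" and h: "linear h" "bij_betw h U U'"
    and eq: "\<And>g x. g \<in> transform_array ` grp M \<Longrightarrow> x \<in> U \<Longrightarrow> h (g x) = g (h x)"
  shows "isomorphic_reps (grp M) (std.form_of ` U) (std.form_of ` U')"
  unfolding isomorphic_reps_def
proof (intro exI conjI ballI)
  \<comment> \<open>\<open>isomorphic_reps\<close> asks for a map that is linear on all functions of
    lists; reading off components first gives one.\<close>
  let ?f = "\<lambda>\<alpha>. std.form_of (h (components_std \<alpha>))"
  have UA: "U \<subseteq> alternating_arrays" "U' \<subseteq> alternating_arrays" using U U' by (auto simp: rep.invariant_def)
  show "linear ?f"
    using linear_compose[OF linear_compose[OF linear_components h(1)] std.linear_form_of] by (simp add: o_def)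
  have f: "?f (std.form_of x) = std.form_of (h x)" for x by (simp add: std.components_form_of)
  have inj: "inj_on std.form_of X" for X :: "((((real, 'n) vec, 'n) vec, 'n) vec) set"
    by (metis std.components_form_of inj_onI)
  show "bij_betw ?f (std.form_of ` U) (std.form_of ` U')"
  proof (rule bij_betw_imageI)
    show "?f ` std.form_of ` U = std.form_of ` U'"
      using h(2) by (simp add: image_image std.components_form_of bij_betw_def flip: image_image[of std.form_of h])
    show "inj_on ?f (std.form_of ` U)"
    proof (rule inj_onI)
      fix \<alpha> \<beta> assume "\<alpha> \<in> std.form_of ` U" "\<beta> \<in> std.form_of ` U" and *: "?f \<alpha> = ?f \<beta>"
      then obtain x y where xy: "x \<in> U" "y \<in> U" "\<alpha> = std.form_of x" "\<beta> = std.form_of y" by blast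
      then have "h x = h y" using * by (metis std.components_form_of)
      then show "\<alpha> = \<beta>" using xy h(2) by (metis bij_betw_def inj_onD)
    qed
  qed
  fix A \<alpha> assume A: "A \<in> grp M" and "\<alpha> \<in> std.form_of ` U"
  then obtain x where x: "x \<in> U" "\<alpha> = std.form_of x" by blast
  have g: "transform_array (matrix_inv A) \<in> transform_array ` grp M" using group_inv[OF A] by blast
  have hx: "h x \<in> U'" using h(2) x(1) by (auto simp: bij_betw_def)
  have "?f (act A \<alpha>) = std.form_of (h (transform_array (matrix_inv A) x))"
    using x UA A by (simp add: act_form_of std.components_form_of subset_iff)
  also have "\<dots> = std.form_of (transform_array (matrix_inv A) (h x))" by (simp add: eq[OF g x(1)])
  also have "\<dots> = act A (?f \<alpha>)"
    using x(2) hx UA A by (simp add: act_form_of std.components_form_of subset_iff)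
  finally show "?f (act A \<alpha>) = act A (?f \<alpha>)" .
qed

sublocale fibre_model alternating_arrays "transform_array ` grp M" "array_flux coeffs" M
  from_array to_array std.form_of
proof (intro fibre_model.intro fibre_model_axioms.intro rep.self_adjoint_intertwiner_axioms)
  show "linear (from_array p)" for p by (rule fr.linear_form_of)
  show "linear (to_array p)" for p
    using linear_compose[OF linear_components linear_transform_array] by (simp add: o_def to_array_def[abs_def])
  show "to_array p (from_array p x) = x" if "x \<in> alternating_arrays" for x p
    by (simp add: to_array_eq[OF fr.form_of_alt_forms[OF that]] fr.components_form_of)
  show "from_array p ` alternating_arrays = forms_at M 3 p" for p by (rule fr.form_of_image)
  show "form_inner M 3 p \<alpha> \<beta> = (to_array p \<alpha> \<bullet> to_array p \<beta>) / 6" for p \<alpha> \<beta>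
    unfolding to_array_def inner_transform_array[OF change(1)]
    by (simp add: form_inner_def sum_lists_length_3 inner_array frame_components_def fact_numeral)
  show "linear (flux_op M p)" for p by (simp add: H_op_frame_flux linear_frame_flux)
  show "flux_op M p (from_array p x) = from_array p (array_flux coeffs x)"
    if "x \<in> alternating_arrays" for x p
  proof -
    have \<omega>: "from_array p x \<in> forms_at M 3 p" by (rule fr.form_of_alt_forms[OF that])
    \<comment> \<open>Here the frame \<open>onb M p\<close> of the definition is exchanged for
      \<open>frame p\<close>, in which the coefficients of \<psi> are known.\<close>
    have "flux_op M p (from_array p x) = frame_flux (frame p) (psi M p) (from_array p x)"
      using frame_flux_frame_act[OF change(1) psi \<omega> subspace_T onb_tangent]
      by (simp add: H_op_frame_flux change(2))
    also have "\<dots> = from_array p (frame_components (frame p) \<dots>)"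
      using fr.form_of_components[OF frame_flux_forms[OF \<omega>]] by simp
    finally show ?thesis by (simp add: components_frame_flux_frames[OF frame] fr.components_form_of)
  qed
  show "dim (std.form_of ` U) = dim U" if "subspace U" for U :: "((((real, 'n) vec, 'n) vec, 'n) vec) set"
    using that by (intro dim_linear_image_inj_on std.linear_form_of) (metis std.components_form_of inj_onI)
qed (rule assoc_bundle_eq irreducible_iff isomorphic_form_of; assumption)+

end

theorem theoremA:
  fixes M :: "('m::{t2_space,second_countable_topology}, 'n::{finite,linorder}) geometry"
  assumes "four_form_geometry M"
  shows
    "(\<forall>p. is_direct_sum (insert None (Some ` perp_ranks M))
            (case_option (flux_ker M p) (\<lambda>d. V_bundle M d p)) (forms_at M 3 p)) \<and>
     (\<forall>d p. linear (flux_op M p) \<and> flux_op M p ` V_bundle M d p \<subseteq> V_bundle M d p \<and>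
            bij_betw (flux_op M p) (V_bundle M d p) (V_bundle M d p)) \<and>
     (\<forall>p. flux_form M p =
            (\<Sum>d\<in>perp_ranks M.
               inv_into (V_bundle M d p) (flux_op M p) (tau M (V_bundle M d) p))) \<and>
     (\<forall>(m::nat) W.
        (\<forall>j\<in>{1..m}. irreducible_subrep (grp M) 3 (W j)) \<and>
        (\<forall>i\<in>{1..m}. \<forall>j\<in>{1..m}. i \<noteq> j \<longrightarrow> \<not> isomorphic_reps (grp M) (W i) (W j)) \<and>
        (\<forall>p. is_direct_sum {1..m} (\<lambda>j. assoc_bundle M 3 (W j) p) (flux_ker_perp M p)) \<longrightarrow>
        (\<exists>a :: nat \<Rightarrow> real.
           (\<forall>j\<in>{1..m}. a j \<noteq> 0 \<and>
              (\<forall>p. \<forall>\<xi>\<in>assoc_bundle M 3 (W j) p. flux_op M p \<xi> = a j *\<^sub>R \<xi>)) \<and>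
           (\<forall>p. flux_form M p =
              (\<Sum>j\<in>{1..m}. (1 / a j) *\<^sub>R tau M (assoc_bundle M 3 (W j)) p))))"
proof -
  obtain \<psi>\<^sub>0 where "\<psi>\<^sub>0 \<in> alt_forms UNIV 4" "\<forall>p. \<forall>e\<in>frames M p. frame_pullback e (psi M p) = \<psi>\<^sub>0"
    using assms unfolding four_form_geometry_def by blast
  then interpret flux_geometry M \<psi>\<^sub>0
    using assms by unfold_locales auto
  show ?thesis
  proof (intro conjI allI impI; (elim conjE)?)
    fix m :: nat and W
    assume "\<forall>j\<in>{1..m}. irreducible_subrep (grp M) 3 (W j)"
      "\<forall>i\<in>{1..m}. \<forall>j\<in>{1..m}. i \<noteq> j \<longrightarrow> \<not> isomorphic_reps (grp M) (W i) (W j)"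
      "\<forall>p. is_direct_sum {1..m} (\<lambda>j. assoc_bundle M 3 (W j) p) (flux_ker_perp M p)"
    then show "\<exists>a :: nat \<Rightarrow> real.
           (\<forall>j\<in>{1..m}. a j \<noteq> 0 \<and>
              (\<forall>p. \<forall>\<xi>\<in>assoc_bundle M 3 (W j) p. flux_op M p \<xi> = a j *\<^sub>R \<xi>)) \<and>
           (\<forall>p. flux_form M p =
              (\<Sum>j\<in>{1..m}. (1 / a j) *\<^sub>R tau M (assoc_bundle M 3 (W j)) p))"
      by (rule multiplicity_free)
  qed (rule direct_sum_forms linear_flux flux_V_bundle flux_form_eq)+
qed

end
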